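(* If all supported nondominated vectors of a bi-objective minimum cost integer flow problem (BMCIF) can be determined in output-polynomial time, then the all distinct cost value flow problem (ACVF) can be solved in output-polynomial time.
   Context: Single-objective minimum cost integer flow problem (MCIF): a connected directed graph $D=(V,A)$ with finite integer capacities $0\le l_{ij}\le u_{ij}$, integer balances $b_i$, and costs $c_{ij}$; a feasible flow is $f\in\mathbb{Z}^A$ with $\sum_{j:(i,j)\in A}f_{ij}-\sum_{j:(j,i)\in A}f_{ji}=b_i$ for all $i$ and $l\le f\le u$; its cost is $c(f)=\sum c_{ij}f_{ij}$. It is assumed that at least one feasible flow exists. ACVF: given an MCIF instance, output flows $f_1,\dots,f_k$ with $c(f_1)<\dots<c(f_k)$ such that every feasible flow $f$ satisfies $c(f)\in\{c(f_1),\dots,c(f_k)\}$. BMCIF: the same feasible set with two cost vectors $c^1,c^2$ and objective $c(f)=(c^1(f),c^2(f))$ minimized in the Pareto sense. A vector $c(f)$ of a feasible flow is nondominated if no feasible $f'$ has $c(f')\le c(f)$ componentwise with $c(f')\neq c(f)$; it is supported if it is the image of an optimal solution of $\min\{\lambda_1c^1(f)+\lambda_2c^2(f)\}$ over feasible flows for some $\lambda_1,\lambda_2>0$. An enumeration algorithm runs in output-polynomial time if its running time is polynomial in the input size and the number of objects output. *)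

theory Defs
  imports
    "HOL-Computational_Algebra.Polynomial"
    "HOL-Library.Log_Nat"
    "Graph_Theory.Digraph_Component"
begin

section \<open>Model of computation\<close>

text \<open>
  Running time is measured on while-programs over binary trees with integers at the leaves,
  under the logarithmic cost criterion: an expression is charged the bit size of the value of
  each of its subexpressions, so that no step handles more bits than it is charged for.  All
  primitive operations are computable in time polynomial in the sizes of their operands and
  results; hence running times in this model and on deterministic multitape Turing machines are
  polynomially related.
\<close>

datatype val = Num int | Cell val val

fun vsize :: "val \<Rightarrow> nat" where
  "vsize (Num z) = 1 + floorlog 2 (nat \<bar>z\<bar>)"
| "vsize (Cell a b) = 1 + vsize a + vsize b"

fun num :: "val \<Rightarrow> int" where
  "num (Num z) = z"
| "num (Cell _ _) = 0"

fun left :: "val \<Rightarrow> val" where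
  "left (Num _) = Num 0"
| "left (Cell a _) = a"

fun right :: "val \<Rightarrow> val" where
  "right (Num _) = Num 0"
| "right (Cell _ b) = b"

definition truth :: "bool \<Rightarrow> val" where
  "truth P = Num (if P then 1 else 0)"

datatype expr =
    Var nat
  | Const int
  | Cons expr expr
  | Left expr
  | Right expr
  | IsCell expr
  | Eq expr expr
  | Less expr expr
  | Add expr expr
  | Sub expr expr
  | Mul expr expr
  | Div expr expr

type_synonym state = "nat \<Rightarrow> val"

fun eval_expr :: "expr \<Rightarrow> state \<Rightarrow> val" where
  "eval_expr (Var x) s = s x"
| "eval_expr (Const z) s = Num z"
| "eval_expr (Cons d e) s = Cell (eval_expr d s) (eval_expr e s)"
| "eval_expr (Left e) s = left (eval_expr e s)"
| "eval_expr (Right e) s = right (eval_expr e s)"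
| "eval_expr (IsCell e) s = truth (\<exists>a b. eval_expr e s = Cell a b)"
| "eval_expr (Eq d e) s = truth (eval_expr d s = eval_expr e s)"
| "eval_expr (Less d e) s = truth (num (eval_expr d s) < num (eval_expr e s))"
| "eval_expr (Add d e) s = Num (num (eval_expr d s) + num (eval_expr e s))"
| "eval_expr (Sub d e) s = Num (num (eval_expr d s) - num (eval_expr e s))"
| "eval_expr (Mul d e) s = Num (num (eval_expr d s) * num (eval_expr e s))"
| "eval_expr (Div d e) s = Num (num (eval_expr d s) div num (eval_expr e s))"

fun subexprs_cost :: "expr \<Rightarrow> state \<Rightarrow> nat" and expr_cost :: "expr \<Rightarrow> state \<Rightarrow> nat" where
  "subexprs_cost (Var x) s = 0"
| "subexprs_cost (Const z) s = 0"
| "subexprs_cost (Cons d e) s = expr_cost d s + expr_cost e s"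
| "subexprs_cost (Left e) s = expr_cost e s"
| "subexprs_cost (Right e) s = expr_cost e s"
| "subexprs_cost (IsCell e) s = expr_cost e s"
| "subexprs_cost (Eq d e) s = expr_cost d s + expr_cost e s"
| "subexprs_cost (Less d e) s = expr_cost d s + expr_cost e s"
| "subexprs_cost (Add d e) s = expr_cost d s + expr_cost e s"
| "subexprs_cost (Sub d e) s = expr_cost d s + expr_cost e s"
| "subexprs_cost (Mul d e) s = expr_cost d s + expr_cost e s"
| "subexprs_cost (Div d e) s = expr_cost d s + expr_cost e s"
| "expr_cost e s = vsize (eval_expr e s) + subexprs_cost e s"

declare expr_cost.simps [simp del]

datatype prog =
    Skip
  | Assign nat expr
  | Seq prog prog
  | If expr prog prog
  | While expr prog

text \<open>\<open>exec c s t s'\<close>: started in state \<open>s\<close>, the program \<open>c\<close> halts in state \<open>s'\<close> after time \<open>t\<close>.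
  Every value other than \<open>Num 0\<close> counts as true.\<close>

inductive exec :: "prog \<Rightarrow> state \<Rightarrow> nat \<Rightarrow> state \<Rightarrow> bool" where
  Skip: "exec Skip s 1 s"
| Assign: "exec (Assign x e) s (1 + expr_cost e s) (s(x := eval_expr e s))"
| Seq: "exec c s t s' \<Longrightarrow> exec d s' t' s'' \<Longrightarrow> exec (Seq c d) s (t + t') s''"
| IfTrue: "eval_expr e s \<noteq> Num 0 \<Longrightarrow> exec c s t s' \<Longrightarrow>
    exec (If e c d) s (1 + expr_cost e s + t) s'"
| IfFalse: "eval_expr e s = Num 0 \<Longrightarrow> exec d s t s' \<Longrightarrow>
    exec (If e c d) s (1 + expr_cost e s + t) s'"
| WhileFalse: "eval_expr e s = Num 0 \<Longrightarrow> exec (While e c) s (1 + expr_cost e s) s"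
| WhileTrue: "eval_expr e s \<noteq> Num 0 \<Longrightarrow> exec c s t s' \<Longrightarrow> exec (While e c) s' t' s'' \<Longrightarrow>
    exec (While e c) s (1 + expr_cost e s + t + t') s''"

inductive_cases exec_SkipE: "exec Skip s t s'"
inductive_cases exec_AssignE: "exec (Assign x e) s t s'"
inductive_cases exec_SeqE: "exec (Seq c d) s t s'"
inductive_cases exec_IfE: "exec (If e c d) s t s'"
inductive_cases exec_WhileE: "exec (While e c) s t s'"

lemma exec_deterministic:
  "exec c s t s' \<Longrightarrow> exec c s u r \<Longrightarrow> u = t \<and> r = s'"
proof (induction arbitrary: u r rule: exec.induct)
  case (Skip s)
  then show ?case by (rule exec_SkipE) simp
next
  case (Assign x e s)
  then show ?case by (rule exec_AssignE) simp
next
  case (Seq c s t s' d t' s'')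
  from Seq.prems show ?case
    by (rule exec_SeqE) (metis Seq.IH)
next
  case (IfTrue e s c t s' d)
  from IfTrue.prems show ?case
    by (rule exec_IfE) (use IfTrue.hyps(1) IfTrue.IH in simp_all)
next
  case (IfFalse e s d t s' c)
  from IfFalse.prems show ?case
    by (rule exec_IfE) (use IfFalse.hyps(1) IfFalse.IH in simp_all)
next
  case (WhileFalse e s c)
  from WhileFalse.prems show ?case
    by (rule exec_WhileE) (use WhileFalse.hyps in simp_all)
next
  case (WhileTrue e s c t s' t' s'')
  from WhileTrue.prems obtain t1 s1 t2 where u: "u = 1 + expr_cost e s + t1 + t2"
    and body: "exec c s t1 s1" and rest: "exec (While e c) s1 t2 r"
    by (rule exec_WhileE) (use WhileTrue.hyps(1) in simp_all)
  from WhileTrue.IH(1)[OF body] have *: "t1 = t" "s1 = s'" by simp_all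
  from WhileTrue.IH(2)[OF rest[unfolded *(2)]] u *(1) show ?case by simp
qed

text \<open>Input and output are held in variable 0; all other variables are initially \<open>Num 0\<close>.\<close>

definition init :: "val \<Rightarrow> state" where
  "init x = (\<lambda>_. Num 0)(0 := x)"

fun vlist :: "val list \<Rightarrow> val" where
  "vlist [] = Num 0"
| "vlist (x # xs) = Cell x (vlist xs)"

text \<open>
  An enumeration problem is given by the relations \<open>code i x\<close>, the value \<open>x\<close> encodes the
  instance \<open>i\<close>, and \<open>sol i ys\<close>, the list \<open>ys\<close> consists of the encodings of exactly the objects
  to be output for \<open>i\<close>.  The polynomial \<open>p\<close> is bivariate, in the input size and the number of
  objects output.
\<close>

definition output_poly_solvable ::
    "('i \<Rightarrow> val \<Rightarrow> bool) \<Rightarrow> ('i \<Rightarrow> val list \<Rightarrow> bool) \<Rightarrow> bool" where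
  "output_poly_solvable code sol \<longleftrightarrow>
    (\<exists>(c :: prog) (p :: nat poly poly). \<forall>i x. code i x \<longrightarrow>
      (\<exists>t s ys. exec c (init x) t s \<and> s 0 = vlist ys \<and> sol i ys \<and>
        t \<le> poly (poly p [:vsize x:]) (length ys)))"


section \<open>Minimum cost integer flows\<close>

record network =
  digraph :: "nat pair_pre_digraph"
  lower :: "nat \<times> nat \<Rightarrow> int"
  upper :: "nat \<times> nat \<Rightarrow> int"
  balance :: "nat \<Rightarrow> int"

type_synonym cost = "nat \<times> nat \<Rightarrow> rat"

abbreviation nodes :: "network \<Rightarrow> nat set" where
  "nodes N \<equiv> pverts (digraph N)"

abbreviation arcs_of :: "network \<Rightarrow> (nat \<times> nat) set" where
  "arcs_of N \<equiv> parcs (digraph N)"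

text \<open>Only the values of a flow on the arcs are relevant.\<close>

definition feasible :: "network \<Rightarrow> (nat \<times> nat \<Rightarrow> int) \<Rightarrow> bool" where
  "feasible N f \<longleftrightarrow>
    (\<forall>i\<in>nodes N. (\<Sum>j | (i, j) \<in> arcs_of N. f (i, j)) - (\<Sum>j | (j, i) \<in> arcs_of N. f (j, i))
                  = balance N i) \<and>
    (\<forall>a\<in>arcs_of N. lower N a \<le> f a \<and> f a \<le> upper N a)"

definition flow_cost :: "network \<Rightarrow> cost \<Rightarrow> (nat \<times> nat \<Rightarrow> int) \<Rightarrow> rat" where
  "flow_cost N c f = (\<Sum>a\<in>arcs_of N. c a * of_int (f a))"

text \<open>\<open>Digraph_Component.connected\<close> is connectedness of the underlying undirected graph.\<close>

definition valid_network :: "network \<Rightarrow> bool" where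
  "valid_network N \<longleftrightarrow>
    pair_fin_digraph (digraph N) \<and> Digraph_Component.connected (with_proj (digraph N)) \<and>
    (\<forall>a\<in>arcs_of N. 0 \<le> lower N a \<and> lower N a \<le> upper N a) \<and>
    (\<exists>f. feasible N f)"


section \<open>Encodings\<close>

text \<open>The nodes and arcs may be listed in any order; numbers are in binary, rational numbers are
  reduced fractions.\<close>

definition rat_code :: "rat \<Rightarrow> val" where
  "rat_code q = (case quotient_of q of (n, d) \<Rightarrow> Cell (Num n) (Num d))"

definition node_code :: "network \<Rightarrow> nat \<Rightarrow> val" where
  "node_code N i = vlist [Num (int i), Num (balance N i)]"

definition arc_code :: "network \<Rightarrow> cost list \<Rightarrow> nat \<times> nat \<Rightarrow> val" where
  "arc_code N cs a =
    vlist ([Num (int (fst a)), Num (int (snd a)), Num (lower N a), Num (upper N a)]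
           @ map (\<lambda>c. rat_code (c a)) cs)"

definition network_code :: "network \<Rightarrow> cost list \<Rightarrow> val \<Rightarrow> bool" where
  "network_code N cs x \<longleftrightarrow>
    (\<exists>vs as. distinct vs \<and> set vs = nodes N \<and> distinct as \<and> set as = arcs_of N \<and>
      x = Cell (vlist (map (node_code N) vs)) (vlist (map (arc_code N cs) as)))"

definition flow_code :: "network \<Rightarrow> (nat \<times> nat \<Rightarrow> int) \<Rightarrow> val \<Rightarrow> bool" where
  "flow_code N f y \<longleftrightarrow>
    (\<exists>as. distinct as \<and> set as = arcs_of N \<and>
      y = vlist (map (\<lambda>a. vlist [Num (int (fst a)), Num (int (snd a)), Num (f a)]) as))"

definition vector_code :: "rat \<times> rat \<Rightarrow> val" where
  "vector_code v = Cell (rat_code (fst v)) (rat_code (snd v))"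


section \<open>The all distinct cost value flow problem\<close>

type_synonym mcif = "network \<times> cost"

fun mcif_code :: "mcif \<Rightarrow> val \<Rightarrow> bool" where
  "mcif_code (N, c) x \<longleftrightarrow> valid_network N \<and> network_code N [c] x"

fun acvf_solution :: "mcif \<Rightarrow> val list \<Rightarrow> bool" where
  "acvf_solution (N, c) ys \<longleftrightarrow>
    (\<exists>fs. list_all2 (flow_code N) fs ys \<and> (\<forall>f\<in>set fs. feasible N f) \<and>
      sorted_wrt (<) (map (flow_cost N c) fs) \<and>
      (\<forall>f. feasible N f \<longrightarrow> flow_cost N c f \<in> set (map (flow_cost N c) fs)))"


section \<open>Supported nondominated vectors of the bi-objective problem\<close>

type_synonym bmcif = "network \<times> cost \<times> cost"

fun bmcif_code :: "bmcif \<Rightarrow> val \<Rightarrow> bool" where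
  "bmcif_code (N, c1, c2) x \<longleftrightarrow> valid_network N \<and> network_code N [c1, c2] x"

fun cost_vector :: "bmcif \<Rightarrow> (nat \<times> nat \<Rightarrow> int) \<Rightarrow> rat \<times> rat" where
  "cost_vector (N, c1, c2) f = (flow_cost N c1 f, flow_cost N c2 f)"

definition vec_le :: "rat \<times> rat \<Rightarrow> rat \<times> rat \<Rightarrow> bool" where
  "vec_le v w \<longleftrightarrow> fst v \<le> fst w \<and> snd v \<le> snd w"

definition nondominated :: "bmcif \<Rightarrow> rat \<times> rat \<Rightarrow> bool" where
  "nondominated I v \<longleftrightarrow>
    (\<exists>f. feasible (fst I) f \<and> v = cost_vector I f) \<and>
    \<not> (\<exists>f'. feasible (fst I) f' \<and> vec_le (cost_vector I f') v \<and> cost_vector I f' \<noteq> v)"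

definition weighted_sum :: "real \<Rightarrow> real \<Rightarrow> rat \<times> rat \<Rightarrow> real" where
  "weighted_sum l1 l2 v = l1 * of_rat (fst v) + l2 * of_rat (snd v)"

definition supported :: "bmcif \<Rightarrow> rat \<times> rat \<Rightarrow> bool" where
  "supported I v \<longleftrightarrow>
    (\<exists>f l1 l2. feasible (fst I) f \<and> v = cost_vector I f \<and> 0 < l1 \<and> 0 < l2 \<and>
      (\<forall>f'. feasible (fst I) f' \<longrightarrow>
        weighted_sum l1 l2 (cost_vector I f) \<le> weighted_sum l1 l2 (cost_vector I f')))"

definition supported_nondominated :: "bmcif \<Rightarrow> (rat \<times> rat) set" where
  "supported_nondominated I = {v. nondominated I v \<and> supported I v}"

definition supported_solution :: "bmcif \<Rightarrow> val list \<Rightarrow> bool" where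
  "supported_solution I ys \<longleftrightarrow>
    (\<exists>vs. distinct vs \<and> set vs = supported_nondominated I \<and> ys = map vector_code vs)"

end

(*
  For the cost vectors (c, -c) every feasible flow is a minimiser of the weighted sum with weights
  (1, 1), and no two distinct image vectors are comparable.  Hence the supported nondominated
  vectors are exactly the pairs (q, -q) with q a cost value, and one oracle call lists all cost
  values.  A flow of prescribed cost q is then found by bisecting the capacity interval of one arc
  after the other, asking the oracle each time whether q is still a cost value.  The restricted
  instance must be feasible for this query to be legitimate; so the lower capacity of the arc is
  first raised to the minimum flow on that arc, which is the only supported nondominated vector for
  the pair of cost vectors (1_a, 1_a).  Restricting capacities never increases the number of cost
  values, so each of the polynomially many queries per value is output-polynomial.
*)

theory Submission
  imports Defs "HOL-Library.While_Combinator"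
begin

section \<open>Polynomial domination\<close>

text \<open>The oracle is itself a program of the model, so a query means running it as a
  subroutine, and nothing is promised on inputs that encode no instance: it may not even halt. This
  is why every query needs a proven feasible flow. Taking the minimum flow on an arc from the same
  oracle avoids having to program a flow algorithm. The time of a query depends on the length of its
  answer, which the program does not know beforehand. Time bounds are therefore relative to a ghost
  resource, which finally becomes the number of cost values of the original network. Polynomial
  bounds do not survive iteration: a loop is polynomial only if all its intermediate states are
  bounded in terms of one quantity fixed before the loop. For the bisection this is the size of the
  original network, since capacities never leave their original intervals; the number of rounds is
  measured by the summed bit lengths of the interval widths. Once all intervals are points, a flow
  of the wanted cost is forced to equal the lower capacities, so it is read off.\<close>

text \<open>A single power serves as normal form of a polynomial bound. The base is at least 2, so
  constants and sums can be absorbed into the exponent; the exponent is uniform over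
  \<open>S\<close>.\<close>

definition poly_bounded :: "'a set \<Rightarrow> ('a \<Rightarrow> nat) \<Rightarrow> ('a \<Rightarrow> nat) \<Rightarrow> bool" where
  "poly_bounded S f g \<longleftrightarrow> (\<exists>k. \<forall>a\<in>S. f a \<le> (g a + 2) ^ k)"

lemma poly_boundedI: "(\<And>a. a \<in> S \<Longrightarrow> f a \<le> (g a + 2) ^ k) \<Longrightarrow> poly_bounded S f g"
  by (auto simp: poly_bounded_def)

lemma poly_bounded_le:
  assumes "\<And>a. a \<in> S \<Longrightarrow> f a \<le> g a"
  shows "poly_bounded S f g"
proof (rule poly_boundedI)
  fix a assume "a \<in> S"
  then show "f a \<le> (g a + 2) ^ 1" using assms by fastforce
qed

lemma poly_bounded_const: "poly_bounded S (\<lambda>_. c) g"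
proof (rule poly_boundedI)
  fix a
  have "c \<le> 2 ^ c" by (rule less_imp_le) simp
  also have "\<dots> \<le> (g a + 2) ^ c" by (rule power_mono) auto
  finally show "c \<le> (g a + 2) ^ c" .
qed

lemma poly_bounded_mult:
  assumes "poly_bounded S f h" "poly_bounded S g h"
  shows "poly_bounded S (\<lambda>a. f a * g a) h"
proof -
  obtain k l where "\<forall>a\<in>S. f a \<le> (h a + 2) ^ k" "\<forall>a\<in>S. g a \<le> (h a + 2) ^ l"
    using assms by (auto simp: poly_bounded_def)
  then show ?thesis
    by (intro poly_boundedI[where k = "k + l"]) (auto simp: power_add intro: mult_mono)
qed

lemma poly_bounded_add:
  assumes "poly_bounded S f h" "poly_bounded S g h"
  shows "poly_bounded S (\<lambda>a. f a + g a) h"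
proof -
  obtain k l where k: "\<forall>a\<in>S. f a \<le> (h a + 2) ^ k" and l: "\<forall>a\<in>S. g a \<le> (h a + 2) ^ l"
    using assms by (auto simp: poly_bounded_def)
  show ?thesis
  proof (rule poly_boundedI[where k = "Suc (max k l)"])
    fix a assume a: "a \<in> S"
    have "f a + g a \<le> (h a + 2) ^ k + (h a + 2) ^ l"
      using a k l add_mono by blast
    also have "\<dots> \<le> (h a + 2) ^ max k l + (h a + 2) ^ max k l"
      by (intro add_mono power_increasing) auto
    also have "\<dots> \<le> (h a + 2) ^ Suc (max k l)"
      by simp
    finally show "f a + g a \<le> (h a + 2) ^ Suc (max k l)" .
  qed
qed

lemma poly_bounded_trans:
  assumes "poly_bounded S f g" "poly_bounded S g h"
  shows "poly_bounded S f h"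
proof -
  obtain k l where k: "\<forall>a\<in>S. f a \<le> (g a + 2) ^ k" and l: "\<forall>a\<in>S. g a \<le> (h a + 2) ^ l"
    using assms by (auto simp: poly_bounded_def)
  show ?thesis
  proof (rule poly_boundedI[where k = "(l + 2) * k"])
    fix a assume a: "a \<in> S"
    have one: "1 \<le> (h a + 2) ^ l" by simp
    have "g a + 2 \<le> (h a + 2) ^ l + 2" using l a by auto
    \<comment> \<open>The offset 2 of the outer base has to be absorbed: X + 2 \<le> 4 X for X \<ge>
      1, and 4 is at most \<open>(h a + 2) ^ 2\<close>. This is where the exponent
      \<open>l + 2\<close> comes from.\<close>
    also have "\<dots> \<le> (h a + 2) ^ l * 4" using one by linarith
    also have "\<dots> \<le> (h a + 2) ^ l * (h a + 2) ^ 2"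
      by (intro mult_left_mono) (auto simp: power2_eq_square)
    also have "\<dots> = (h a + 2) ^ (l + 2)" by (simp only: power_add)
    finally have "(g a + 2) ^ k \<le> ((h a + 2) ^ (l + 2)) ^ k"
      by (rule power_mono) simp
    then have "(g a + 2) ^ k \<le> (h a + 2) ^ ((l + 2) * k)"
      by (simp only: power_mult)
    then show "f a \<le> (h a + 2) ^ ((l + 2) * k)"
      using k a by (meson order_trans)
  qed
qed

lemma poly_bounded_mono:
  assumes "poly_bounded S f g" "\<And>a. a \<in> S \<Longrightarrow> f' a \<le> f a"
  shows "poly_bounded S f' g"
  using assms unfolding poly_bounded_def by (meson order_trans)

lemma poly_bounded_subst:
  assumes "poly_bounded S f g" "h ` S' \<subseteq> S"
  shows "poly_bounded S' (\<lambda>a. f (h a)) (\<lambda>a. g (h a))"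
  using assms unfolding poly_bounded_def by blast

lemma poly_bounded_subset: "poly_bounded S f g \<Longrightarrow> S' \<subseteq> S \<Longrightarrow> poly_bounded S' f g"
  unfolding poly_bounded_def by blast

text \<open>Translates the polynomials of \<open>output_poly_solvable\<close> into powers. Two
  nested inductions are needed: on the outer polynomial, whose variable is the input size
  \<open>n\<close>, and on its coefficients, which are polynomials in the output length
  \<open>m\<close>.\<close>

lemma poly_bounded_nat_poly: "\<exists>k. \<forall>m n. poly (poly p [:n:]) m \<le> (m + n + 2 :: nat) ^ k"
proof -
  have 1: "poly_bounded UNIV (poly q) (\<lambda>m. m)" for q :: "nat poly"
  proof (induction q)
    case 0
    then show ?case by (simp add: poly_bounded_const)
  next
    case (pCons a q)
    then have "poly_bounded UNIV (\<lambda>x. a + x * poly q x) (\<lambda>m. m)"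
      by (intro poly_bounded_add poly_bounded_mult poly_bounded_const) (rule poly_bounded_le, simp)
    moreover have "poly (pCons a q) = (\<lambda>x. a + x * poly q x)" by auto
    ultimately show ?case by simp
  qed
  have "poly_bounded UNIV (\<lambda>(m, n). poly (poly p [:n:]) m) (\<lambda>(m, n). m + n)"
  proof (induction p)
    case 0
    then show ?case by (simp add: poly_bounded_const case_prod_beta)
  next
    case (pCons q p)
    have "poly_bounded UNIV (\<lambda>z. poly q (fst z)) (\<lambda>z. fst z + snd z :: nat)"
      by (rule poly_bounded_trans[OF poly_bounded_subst[OF 1, where S' = UNIV and h = fst]])
        (auto intro: poly_bounded_le)
    moreover have "poly_bounded UNIV (\<lambda>z. snd z) (\<lambda>z. fst z + snd z :: nat)"
      by (rule poly_bounded_le) simp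
    ultimately have "poly_bounded UNIV
        (\<lambda>z. poly q (fst z) + snd z * poly (poly p [:snd z:]) (fst z)) (\<lambda>z. fst z + snd z)"
      using pCons by (auto simp: case_prod_beta intro!: poly_bounded_add poly_bounded_mult)
    then show ?case by (simp add: case_prod_beta)
  qed
  then obtain k where "\<forall>z\<in>UNIV. (case z of (m, n) \<Rightarrow> poly (poly p [:n:]) m)
      \<le> ((case z of (m, n) \<Rightarrow> m + n) + 2) ^ k"
    unfolding poly_bounded_def by blast
  then show ?thesis by auto
qed

text \<open>The way back from powers to polynomials: \<open>[:[:2, 1:], [:1:]:]\<close> is 2 + m +
  n, with inner variable \<open>m\<close> and outer variable \<open>n\<close>.\<close>

lemma power_as_nat_poly:
  "poly (poly ([:[:2, 1:], [:1:]:] ^ k) [:n:]) m = (m + n + 2 :: nat) ^ k"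
  by (simp add: poly_power algebra_simps)


section \<open>Costs and frames of while-programs\<close>

lemma vsize_pos: "1 \<le> vsize v"
  by (cases v) auto

lemma vsize_num: "vsize (Num (num v)) \<le> vsize v"
  by (cases v) (auto simp: floorlog_def)

lemma vsize_left: "vsize (left v) \<le> vsize v"
  by (cases v) (auto simp: floorlog_def)

lemma vsize_right: "vsize (right v) \<le> vsize v"
  by (cases v) (auto simp: floorlog_def)

lemma vsize_truth: "vsize (truth b) \<le> 2"
  by (cases b) (simp_all add: truth_def floorlog_le_iff)

lemma vsize_Num_mono: "\<bar>x\<bar> \<le> \<bar>y\<bar> \<Longrightarrow> vsize (Num x) \<le> vsize (Num y)"
  by (simp add: floorlog_mono nat_mono)

lemma abs_less_power_vsize: "\<bar>x\<bar> < 2 ^ (vsize (Num x) - 1)"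
  using floorlog_leD[of 2 "nat \<bar>x\<bar>" "vsize (Num x) - 1"] by (simp add: nat_less_iff)

lemma vsize_Num_le: "\<bar>x\<bar> < 2 ^ n \<Longrightarrow> vsize (Num x) \<le> n + 1"
  using floorlog_leI[of "nat \<bar>x\<bar>" 2 n] by (simp add: nat_less_iff)

text \<open>The bit lengths of \<open>x\<close> and \<open>y\<close> plus one carry bit suffice. Of
  the two units charged for the leaves \<open>Num x\<close> and \<open>Num y\<close>, one pays for
  the leaf \<open>Num z\<close> and one for the carry. The hypothesis covers both sum and
  difference.\<close>

lemma vsize_add:
  assumes "\<bar>z\<bar> \<le> \<bar>x\<bar> + \<bar>y\<bar>"
  shows "vsize (Num z) \<le> vsize (Num x) + vsize (Num y)"
proof -
  define m n where "m = vsize (Num x) - 1" and "n = vsize (Num y) - 1"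
  have "\<bar>x\<bar> < 2 ^ m" "\<bar>y\<bar> < 2 ^ n"
    unfolding m_def n_def by (rule abs_less_power_vsize)+
  moreover have "(2::int) ^ m \<le> 2 ^ (m + n)" "(2::int) ^ n \<le> 2 ^ (m + n)"
    by (rule power_increasing; simp)+
  moreover have "(2::int) ^ (m + n + 1) = 2 * 2 ^ (m + n)" by simp
  ultimately have "\<bar>z\<bar> < 2 ^ (m + n + 1)" using assms by linarith
  from vsize_Num_le[OF this] show ?thesis
    unfolding m_def n_def by simp
qed

lemma vsize_mult: "vsize (Num (x * y)) \<le> vsize (Num x) + vsize (Num y)"
proof -
  define m n where "m = vsize (Num x) - 1" and "n = vsize (Num y) - 1"
  have "\<bar>x\<bar> < 2 ^ m" "\<bar>y\<bar> < 2 ^ n"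
    unfolding m_def n_def by (rule abs_less_power_vsize)+
  then have "\<bar>x * y\<bar> < 2 ^ (m + n)"
    by (simp add: abs_mult power_add mult_strict_mono)
  from vsize_Num_le[OF this] show ?thesis
    unfolding m_def n_def by simp
qed

text \<open>Rounding towards minus infinity is harmless: for negative \<open>x\<close> and positive
  \<open>y\<close> the quotient lies between \<open>x\<close> and -1. A negative divisor is handled
  by changing both signs, and division by 0 gives 0.\<close>

lemma abs_div_le: "\<bar>x div y\<bar> \<le> \<bar>x\<bar>" for x y :: int
proof -
  have pos: "\<bar>x div y\<bar> \<le> \<bar>x\<bar>" if "0 < y" for x y :: int
  proof (cases "0 \<le> x")
    case True
    then show ?thesis
      using that zdiv_mono2[of x 1 y] by (simp add: pos_imp_zdiv_nonneg_iff)
  next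
    case False
    then show ?thesis
      using that zdiv_mono2_neg[of x 1 y] pos_imp_zdiv_neg_iff[of y x] by simp
  qed
  consider "0 < y" | "y = 0" | "0 < - y" by linarith
  then show ?thesis
    using pos[of y x] pos[of "- y" "- x"] by cases simp_all
qed

lemma expr_cost_eq: "expr_cost e s = vsize (eval_expr e s) + subexprs_cost e s"
  by (cases e) (simp_all add: expr_cost.simps)

lemma vsize_le_expr_cost: "vsize (eval_expr e s) \<le> expr_cost e s"
  by (simp add: expr_cost_eq)

text \<open>The expression is fixed, so its operations, each of which at most adds up the sizes of
  its operands, are constant in number. The exponent may depend on \<open>e\<close>.\<close>

lemma expr_cost_poly_bounded: "poly_bounded UNIV (\<lambda>x. expr_cost e (init x)) vsize"
proof (induction e)
  case (Var y)
  then show ?case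
    by (auto simp: expr_cost_eq init_def floorlog_def Suc_le_eq vsize_pos[simplified Suc_le_eq One_nat_def] intro!: poly_bounded_le)
next
  case (Const z)
  then show ?case by (simp add: expr_cost_eq poly_bounded_const)
next
  case (Cons d e)
  have "poly_bounded UNIV (\<lambda>x. (expr_cost d (init x) + expr_cost e (init x)) +
      (expr_cost d (init x) + expr_cost e (init x)) + 1) vsize"
    using Cons by (intro poly_bounded_add poly_bounded_const)
  then show ?case
    by (rule poly_bounded_mono)
      (use vsize_le_expr_cost[of d] vsize_le_expr_cost[of e] in
        \<open>auto simp: expr_cost_eq[of "expr.Cons _ _"] intro!: add_mono order_trans[OF add_mono]\<close>)
next
  case (Left e)
  have "poly_bounded UNIV (\<lambda>x. expr_cost e (init x) + expr_cost e (init x)) vsize"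
    using Left by (intro poly_bounded_add)
  then show ?case
    by (rule poly_bounded_mono)
      (use order_trans[OF vsize_left vsize_le_expr_cost] in \<open>simp add: expr_cost_eq[of "expr.Left _"]\<close>)
next
  case (Right e)
  have "poly_bounded UNIV (\<lambda>x. expr_cost e (init x) + expr_cost e (init x)) vsize"
    using Right by (intro poly_bounded_add)
  then show ?case
    by (rule poly_bounded_mono)
      (use order_trans[OF vsize_right vsize_le_expr_cost] in \<open>simp add: expr_cost_eq[of "expr.Right _"]\<close>)
next
  case (IsCell e)
  have "poly_bounded UNIV (\<lambda>x. 2 + expr_cost e (init x)) vsize"
    using IsCell by (intro poly_bounded_add poly_bounded_const)
  then show ?case
    by (rule poly_bounded_mono) (simp add: expr_cost_eq[of "expr.IsCell _"] vsize_truth)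
next
  case (Eq d e)
  have "poly_bounded UNIV (\<lambda>x. 2 + (expr_cost d (init x) + expr_cost e (init x))) vsize"
    using Eq by (intro poly_bounded_add poly_bounded_const)
  then show ?case
    by (rule poly_bounded_mono) (simp add: expr_cost_eq[of "expr.Eq _ _"] vsize_truth)
next
  case (Less d e)
  have "poly_bounded UNIV (\<lambda>x. 2 + (expr_cost d (init x) + expr_cost e (init x))) vsize"
    using Less by (intro poly_bounded_add poly_bounded_const)
  then show ?case
    by (rule poly_bounded_mono) (simp add: expr_cost_eq[of "expr.Less _ _"] vsize_truth)
next
  case (Add d e)
  have "poly_bounded UNIV (\<lambda>x. (expr_cost d (init x) + expr_cost e (init x)) +
      (expr_cost d (init x) + expr_cost e (init x))) vsize"
    using Add by (intro poly_bounded_add)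
  then show ?case
  proof (rule poly_bounded_mono)
    fix x
    let ?d = "num (eval_expr d (init x))" and ?e = "num (eval_expr e (init x))"
    have "vsize (Num (?d + ?e)) \<le> vsize (Num ?d) + vsize (Num ?e)" by (rule vsize_add) simp
    then show "expr_cost (expr.Add d e) (init x) \<le> (expr_cost d (init x) + expr_cost e (init x)) +
      (expr_cost d (init x) + expr_cost e (init x))"
      using order_trans[OF vsize_num vsize_le_expr_cost, of d "init x"]
        order_trans[OF vsize_num vsize_le_expr_cost, of e "init x"]
      by (simp add: expr_cost_eq[of "expr.Add _ _"] del: vsize.simps)
  qed
next
  case (Sub d e)
  have "poly_bounded UNIV (\<lambda>x. (expr_cost d (init x) + expr_cost e (init x)) +
      (expr_cost d (init x) + expr_cost e (init x))) vsize"
    using Sub by (intro poly_bounded_add)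
  then show ?case
  proof (rule poly_bounded_mono)
    fix x
    let ?d = "num (eval_expr d (init x))" and ?e = "num (eval_expr e (init x))"
    have "vsize (Num (?d - ?e)) \<le> vsize (Num ?d) + vsize (Num ?e)" by (rule vsize_add) simp
    then show "expr_cost (expr.Sub d e) (init x) \<le> (expr_cost d (init x) + expr_cost e (init x)) +
      (expr_cost d (init x) + expr_cost e (init x))"
      using order_trans[OF vsize_num vsize_le_expr_cost, of d "init x"]
        order_trans[OF vsize_num vsize_le_expr_cost, of e "init x"]
      by (simp add: expr_cost_eq[of "expr.Sub _ _"] del: vsize.simps)
  qed
next
  case (Mul d e)
  have "poly_bounded UNIV (\<lambda>x. (expr_cost d (init x) + expr_cost e (init x)) +
      (expr_cost d (init x) + expr_cost e (init x))) vsize"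
    using Mul by (intro poly_bounded_add)
  then show ?case
  proof (rule poly_bounded_mono)
    fix x
    let ?d = "num (eval_expr d (init x))" and ?e = "num (eval_expr e (init x))"
    have "vsize (Num (?d * ?e)) \<le> vsize (Num ?d) + vsize (Num ?e)" by (rule vsize_mult)
    then show "expr_cost (expr.Mul d e) (init x) \<le> (expr_cost d (init x) + expr_cost e (init x)) +
      (expr_cost d (init x) + expr_cost e (init x))"
      using order_trans[OF vsize_num vsize_le_expr_cost, of d "init x"]
        order_trans[OF vsize_num vsize_le_expr_cost, of e "init x"]
      by (simp add: expr_cost_eq[of "expr.Mul _ _"] del: vsize.simps)
  qed
next
  case (Div d e)
  have "poly_bounded UNIV (\<lambda>x. (expr_cost d (init x) + expr_cost e (init x)) +
      expr_cost d (init x)) vsize"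
    using Div by (intro poly_bounded_add)
  then show ?case
  proof (rule poly_bounded_mono)
    fix x
    let ?d = "num (eval_expr d (init x))" and ?e = "num (eval_expr e (init x))"
    have "vsize (Num (?d div ?e)) \<le> vsize (Num ?d)" by (rule vsize_Num_mono) (rule abs_div_le)
    then show "expr_cost (expr.Div d e) (init x) \<le> (expr_cost d (init x) + expr_cost e (init x)) +
      expr_cost d (init x)"
      using order_trans[OF vsize_num vsize_le_expr_cost, of d "init x"]
      by (simp add: expr_cost_eq[of "expr.Div _ _"] del: vsize.simps)
  qed
qed

section \<open>Frames: registers that a program does not touch\<close>

fun expr_bound :: "expr \<Rightarrow> nat" where
  "expr_bound (Var x) = Suc x"
| "expr_bound (Const z) = 0"
| "expr_bound (Cons d e) = max (expr_bound d) (expr_bound e)"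
| "expr_bound (Left e) = expr_bound e"
| "expr_bound (Right e) = expr_bound e"
| "expr_bound (IsCell e) = expr_bound e"
| "expr_bound (Eq d e) = max (expr_bound d) (expr_bound e)"
| "expr_bound (Less d e) = max (expr_bound d) (expr_bound e)"
| "expr_bound (Add d e) = max (expr_bound d) (expr_bound e)"
| "expr_bound (Sub d e) = max (expr_bound d) (expr_bound e)"
| "expr_bound (Mul d e) = max (expr_bound d) (expr_bound e)"
| "expr_bound (Div d e) = max (expr_bound d) (expr_bound e)"

fun prog_bound :: "prog \<Rightarrow> nat" where
  "prog_bound Skip = 0"
| "prog_bound (Assign x e) = max (Suc x) (expr_bound e)"
| "prog_bound (Seq c d) = max (prog_bound c) (prog_bound d)"
| "prog_bound (If e c d) = max (expr_bound e) (max (prog_bound c) (prog_bound d))"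
| "prog_bound (While e c) = max (expr_bound e) (prog_bound c)"

definition below :: "nat \<Rightarrow> state \<Rightarrow> state \<Rightarrow> state" where
  "below n s w = (\<lambda>x. if x < n then s x else w x)"

lemma eval_expr_below: "expr_bound e \<le> n \<Longrightarrow> eval_expr e (below n s w) = eval_expr e s"
  by (induction e) (auto simp: below_def)

lemma expr_cost_below: "expr_bound e \<le> n \<Longrightarrow> expr_cost e (below n s w) = expr_cost e s"
  by (induction e) (auto simp: expr_cost.simps eval_expr_below, auto simp: below_def)

text \<open>Frame rule: neither the result nor the running time of \<open>c\<close> depends on
  registers from \<open>n\<close> on, so data can be parked there while \<open>c\<close>
  runs.\<close>

lemma exec_below: "exec c s t s' \<Longrightarrow> prog_bound c \<le> n \<Longrightarrow> exec c (below n s w) t (below n s' w)"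
proof (induction rule: exec.induct)
  case (Skip s)
  show ?case by (rule exec.Skip)
next
  case (Assign x e s)
  have *: "below n (s(x := eval_expr e s)) w = (below n s w)(x := eval_expr e (below n s w))"
    using Assign by (auto simp: below_def eval_expr_below[unfolded below_def])
  show ?case
    unfolding * using exec.Assign[of x e "below n s w"] Assign
    by (simp add: expr_cost_below del: fun_upd_apply)
next
  case (Seq c s t s' d t' s'')
  then show ?case by (auto intro: exec.intros)
next
  case (IfTrue e s c t s' d)
  then show ?case
    using exec.IfTrue[of e "below n s w" c t "below n s' w" d]
    by (simp add: expr_cost_below eval_expr_below)
next
  case (IfFalse e s d t s' c)
  then show ?case
    using exec.IfFalse[of e "below n s w" d t "below n s' w" c]
    by (simp add: expr_cost_below eval_expr_below)
next
  case (WhileFalse e s c)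
  then show ?case
    using exec.WhileFalse[of e "below n s w" c]
    by (simp add: expr_cost_below eval_expr_below)
next
  case (WhileTrue e s c t s' t' s'')
  then show ?case
    using exec.WhileTrue[of e "below n s w" c t "below n s' w" t' "below n s'' w"]
    by (simp add: expr_cost_below eval_expr_below)
qed

lemma exec_unchanged: "exec c s t s' \<Longrightarrow> prog_bound c \<le> x \<Longrightarrow> s' x = s x"
  by (induction rule: exec.induct) auto

text \<open>Under the logarithmic cost criterion every assigned value has been paid for bit by bit,
  so time bounds growth. All bounds on output sizes rest on this.\<close>

lemma exec_vsize: "exec c s t s' \<Longrightarrow> vsize (s' x) \<le> vsize (s x) + t"
proof (induction rule: exec.induct)
  case (Assign y e s)
  then show ?case using vsize_le_expr_cost[of e s] by auto
qed auto

primrec clear :: "nat \<Rightarrow> prog" where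
  "clear 0 = Skip"
| "clear (Suc n) = Seq (clear n) (Assign (Suc n) (Const 0))"

text \<open>Each reset costs 2, one for the assignment and one for the size of \<open>Num 0\<close>;
  \<open>Skip\<close> costs 1. Register 0 is spared because it holds the output.\<close>

lemma exec_clear:
  "exec (clear n) s (1 + 2 * n) (\<lambda>x. if 0 < x \<and> x \<le> n then Num 0 else s x)"
proof (induction n)
  case 0
  have "(\<lambda>x. if 0 < x \<and> x \<le> 0 then Num 0 else s x) = s" by auto
  then show ?case using exec.Skip[of s] by simp
next
  case (Suc n)
  have *: "(\<lambda>x. if 0 < x \<and> x \<le> Suc n then Num 0 else s x) =
      (\<lambda>x. if 0 < x \<and> x \<le> n then Num 0 else s x)(Suc n := Num 0)"
    by auto
  show ?case
    using exec.Seq[OF Suc exec.Assign[of "Suc n" "Const 0"]]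
    unfolding * by (simp add: expr_cost.simps floorlog_def)
qed


section \<open>Polynomial-time transformations\<close>

text \<open>The set \<open>S\<close> consists of ghost parameters, of which the program sees only the encoding \<open>u\<close>.
  Besides the input size, the time may depend polynomially on the resource \<open>r\<close>, which plays the
  role of the output size.  All variables but 0 are reset in the end, so that programs compose.\<close>

definition pt :: "'a set \<Rightarrow> ('a \<Rightarrow> nat) \<Rightarrow> ('a \<Rightarrow> val) \<Rightarrow> ('a \<Rightarrow> val) \<Rightarrow> bool" where
  "pt S r u v \<longleftrightarrow> (\<exists>c T. (\<forall>a\<in>S. exec c (init (u a)) (T a) (init (v a))) \<and>
    poly_bounded S T (\<lambda>a. r a + vsize (u a)))"

lemma ptI:
  assumes "\<And>a. a \<in> S \<Longrightarrow> exec c (init (u a)) (T a) (init (v a))"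
    and "poly_bounded S T (\<lambda>a. r a + vsize (u a))"
  shows "pt S r u v"
  using assms unfolding pt_def by blast

lemma ptE:
  assumes "pt S r u v"
  obtains c T where "\<And>a. a \<in> S \<Longrightarrow> exec c (init (u a)) (T a) (init (v a))"
    and "poly_bounded S T (\<lambda>a. r a + vsize (u a))"
  using assms unfolding pt_def by blast

lemma init_0 [simp]: "init x 0 = x"
  by (simp add: init_def)

lemma pt_output_size:
  assumes "pt S r u v"
  shows "poly_bounded S (\<lambda>a. vsize (v a)) (\<lambda>a. r a + vsize (u a))"
proof -
  obtain c T where c: "\<And>a. a \<in> S \<Longrightarrow> exec c (init (u a)) (T a) (init (v a))"
    and T: "poly_bounded S T (\<lambda>a. r a + vsize (u a))"
    using assms by (rule ptE) blast
  have "poly_bounded S (\<lambda>a. vsize (u a) + T a) (\<lambda>a. r a + vsize (u a))"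
    by (rule poly_bounded_add[OF poly_bounded_le T]) simp
  then show ?thesis
    by (rule poly_bounded_mono) (use exec_vsize[OF c, of _ 0] in auto)
qed

text \<open>The second time bound refers to the size of the intermediate value \<open>v a\<close>,
  which \<open>pt_output_size\<close> turns into a bound in the original input.\<close>

lemma pt_comp:
  assumes "pt S r u v" "pt S r v w"
  shows "pt S r u w"
proof -
  let ?b = "\<lambda>a. r a + vsize (u a)"
  obtain c T where c: "\<And>a. a \<in> S \<Longrightarrow> exec c (init (u a)) (T a) (init (v a))"
    and T: "poly_bounded S T ?b"
    using assms(1) by (rule ptE) blast
  obtain d T' where d: "\<And>a. a \<in> S \<Longrightarrow> exec d (init (v a)) (T' a) (init (w a))"
    and T': "poly_bounded S T' (\<lambda>a. r a + vsize (v a))"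
    using assms(2) by (rule ptE) blast
  have "poly_bounded S (\<lambda>a. r a + vsize (v a)) ?b"
    by (rule poly_bounded_add[OF poly_bounded_le pt_output_size[OF assms(1)]]) simp
  from poly_bounded_trans[OF T' this] T
  have "poly_bounded S (\<lambda>a. T a + T' a) ?b" by (intro poly_bounded_add)
  then show ?thesis
    by (intro ptI[where c = "Seq c d"]) (use c d exec.Seq in blast)+
qed

text \<open>The program sees only encodings, so ghost parameters can be reindexed without touching
  program or exponent.\<close>

lemma pt_subst:
  assumes "pt S r u v" "\<And>a. a \<in> S' \<Longrightarrow> h a \<in> S"
    and "\<And>a. a \<in> S' \<Longrightarrow> r (h a) = r' a"
    and "\<And>a. a \<in> S' \<Longrightarrow> u (h a) = u' a"
    and "\<And>a. a \<in> S' \<Longrightarrow> v (h a) = v' a"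
  shows "pt S' r' u' v'"
proof -
  obtain c T where c: "\<And>a. a \<in> S \<Longrightarrow> exec c (init (u a)) (T a) (init (v a))"
    and "poly_bounded S T (\<lambda>a. r a + vsize (u a))"
    using assms(1) by (rule ptE) blast
  then obtain k where k: "\<And>a. a \<in> S \<Longrightarrow> T a \<le> (r a + vsize (u a) + 2) ^ k"
    unfolding poly_bounded_def by blast
  show ?thesis
  proof (rule ptI)
    fix a assume a: "a \<in> S'"
    show "exec c (init (u' a)) (T (h a)) (init (v' a))"
      using c[OF assms(2)[OF a]] assms(4,5)[OF a] by simp
  next
    show "poly_bounded S' (\<lambda>a. T (h a)) (\<lambda>a. r' a + vsize (u' a))"
    proof (rule poly_boundedI)
      fix a assume a: "a \<in> S'"
      show "T (h a) \<le> (r' a + vsize (u' a) + 2) ^ k"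
        using k[OF assms(2)[OF a]] assms(3,4)[OF a] by simp
    qed
  qed
qed

lemma pt_cong:
  assumes "pt S r u v" "\<And>a. a \<in> S \<Longrightarrow> u a = u' a" "\<And>a. a \<in> S \<Longrightarrow> v a = v' a"
  shows "pt S r u' v'"
  by (rule pt_subst[OF assms(1), where h = "\<lambda>a. a"]) (use assms in auto)

lemma pt_subset: "pt S r u v \<Longrightarrow> S' \<subseteq> S \<Longrightarrow> pt S' r u v"
  by (erule pt_subst[where h = "\<lambda>a. a"]) auto

text \<open>Lets a subroutine that is charged by its own resource, such as the length of an oracle
  answer, be charged to the resource of its caller.\<close>

lemma pt_resource:
  assumes "pt S r' u v" "poly_bounded S r' (\<lambda>a. r a + vsize (u a))"
  shows "pt S r u v"
proof -
  obtain c T where c: "\<And>a. a \<in> S \<Longrightarrow> exec c (init (u a)) (T a) (init (v a))"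
    and T: "poly_bounded S T (\<lambda>a. r' a + vsize (u a))"
    using assms(1) by (rule ptE) blast
  have "poly_bounded S (\<lambda>a. r' a + vsize (u a)) (\<lambda>a. r a + vsize (u a))"
    by (rule poly_bounded_add[OF assms(2) poly_bounded_le]) simp
  from poly_bounded_trans[OF T this] c show ?thesis by (intro ptI)
qed

lemma pt_expr:
  assumes "\<And>a. a \<in> S \<Longrightarrow> eval_expr e (init (u a)) = v a"
  shows "pt S r u v"
proof (rule ptI)
  fix a assume a: "a \<in> S"
  have "(init (u a))(0 := v a) = init (v a)" by (auto simp: init_def)
  then show "exec (Assign 0 e) (init (u a)) (1 + expr_cost e (init (u a))) (init (v a))"
    using exec.Assign[of 0 e "init (u a)"] assms[OF a] by simp
next
  have "poly_bounded S (\<lambda>a. 1 + expr_cost e (init (u a))) (\<lambda>a. vsize (u a))"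
    by (intro poly_bounded_add poly_bounded_const)
      (rule poly_bounded_subst[OF expr_cost_poly_bounded], simp)
  then show "poly_bounded S (\<lambda>a. 1 + expr_cost e (init (u a))) (\<lambda>a. r a + vsize (u a))"
    by (rule poly_bounded_trans) (rule poly_bounded_le, simp)
qed

text \<open>The companion \<open>w a\<close> waits in a register beyond those of \<open>c\<close>,
  and the frame rule carries it through the run. This yields a calculus in which a transformation
  acts on one component of a pair.\<close>

lemma pt_first:
  assumes "pt S r u v"
  shows "pt S r (\<lambda>a. Cell (u a) (w a)) (\<lambda>a. Cell (v a) (w a))"
proof -
  obtain c T where c: "\<And>a. a \<in> S \<Longrightarrow> exec c (init (u a)) (T a) (init (v a))"
    and T: "poly_bounded S T (\<lambda>a. r a + vsize (u a))"
    using assms by (rule ptE) blast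
  \<comment> \<open>The spare register must lie beyond all variables of \<open>c\<close> and differ
    from register 0, hence the \<open>max 1\<close>.\<close>
  define n where "n = max 1 (prog_bound c)"
  have n: "0 < n" "prog_bound c \<le> n" by (auto simp: n_def)
  let ?prog = "Seq (Seq (Seq (Seq (Assign n (Right (Var 0))) (Assign 0 (Left (Var 0)))) c)
      (Assign 0 (Cons (Var 0) (Var n)))) (Assign n (Const 0))"
  have exec: "exec ?prog (init (Cell (u a) (w a)))
      (1 + expr_cost (Right (Var 0)) (init (Cell (u a) (w a))) +
        (1 + expr_cost (Left (Var 0)) (init (Cell (u a) (w a)))) + T a +
        (1 + expr_cost (Cons (Var 0) (Var n)) (below n (init (v a)) (\<lambda>_. w a))) +
        (1 + expr_cost (Const 0) (init (u a)))) (init (Cell (v a) (w a)))"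
    if a: "a \<in> S" for a
  proof -
    let ?s = "init (Cell (u a) (w a))"
    let ?w = "(\<lambda>_. Num 0)(n := w a)"
    have 1: "exec (Assign n (Right (Var 0))) ?s (1 + expr_cost (Right (Var 0)) ?s)
        (?s(n := w a))"
      using exec.Assign[of n "Right (Var 0)" ?s] by simp
    have 2: "exec (Assign 0 (Left (Var 0))) (?s(n := w a)) (1 + expr_cost (Left (Var 0)) ?s)
        (below n (init (u a)) ?w)"
    proof -
      have "(?s(n := w a))(0 := u a) = below n (init (u a)) ?w"
        using n by (auto simp: init_def below_def)
      then show ?thesis
        using exec.Assign[of 0 "Left (Var 0)" "?s(n := w a)"] n by (simp add: expr_cost.simps)
    qed
    have 3: "exec c (below n (init (u a)) ?w) (T a) (below n (init (v a)) ?w)"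
      by (rule exec_below[OF c[OF a] n(2)])
    let ?s' = "below n (init (v a)) ?w"
    have 4: "exec (Assign 0 (Cons (Var 0) (Var n))) ?s'
      (1 + expr_cost (Cons (Var 0) (Var n)) (below n (init (v a)) (\<lambda>_. w a)))
        (?s'(0 := Cell (v a) (w a)))"
      using exec.Assign[of 0 "Cons (Var 0) (Var n)" ?s'] n
      by (simp add: expr_cost.simps below_def)
    have 5: "exec (Assign n (Const 0)) (?s'(0 := Cell (v a) (w a)))
        (1 + expr_cost (Const 0) (init (u a))) (init (Cell (v a) (w a)))"
    proof -
      have "(?s'(0 := Cell (v a) (w a)))(n := Num 0) = init (Cell (v a) (w a))"
        using n by (auto simp: init_def below_def)
      then show ?thesis
        using exec.Assign[of n "Const 0" "?s'(0 := Cell (v a) (w a))"]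
        by (simp add: expr_cost.simps)
    qed
    show ?thesis
      by (rule exec.Seq[OF exec.Seq[OF exec.Seq[OF exec.Seq[OF 1 2] 3] 4] 5])
  qed
  let ?b = "\<lambda>a. r a + vsize (Cell (u a) (w a))"
  have Tb: "poly_bounded S T ?b"
    by (rule poly_bounded_trans[OF T]) (rule poly_bounded_le, simp)
  have v: "poly_bounded S (\<lambda>a. vsize (v a)) ?b"
    by (rule poly_bounded_trans[OF pt_output_size[OF assms]]) (rule poly_bounded_le, simp)
  have "poly_bounded S (\<lambda>a. (vsize (w a) + vsize (Cell (u a) (w a))) +
      (vsize (u a) + vsize (Cell (u a) (w a))) + T a +
      (2 * (vsize (v a) + vsize (w a))) + 10) ?b"
    by (intro poly_bounded_add poly_bounded_mult poly_bounded_const Tb v poly_bounded_le) auto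
  then have "poly_bounded S (\<lambda>a. 1 + expr_cost (Right (Var 0)) (init (Cell (u a) (w a))) +
        (1 + expr_cost (Left (Var 0)) (init (Cell (u a) (w a)))) + T a +
        (1 + expr_cost (Cons (Var 0) (Var n)) (below n (init (v a)) (\<lambda>_. w a))) +
        (1 + expr_cost (Const 0) (init (u a)))) ?b"
    by (rule poly_bounded_mono) (use n in \<open>simp add: expr_cost.simps below_def floorlog_def\<close>)
  with exec show ?thesis by (rule ptI)
qed

lemma pt_id: "pt S r u u"
  by (rule pt_expr[where e = "Var 0"]) simp

lemma pt_let:
  assumes "pt S r u v" "pt S r (\<lambda>a. Cell (v a) (u a)) w"
  shows "pt S r u w"
proof -
  have "pt S r u (\<lambda>a. Cell (u a) (u a))"
    by (rule pt_expr[where e = "Cons (Var 0) (Var 0)"]) simp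
  from pt_comp[OF pt_comp[OF this pt_first[OF assms(1)]] assms(2)] show ?thesis .
qed

lemma pt_second:
  assumes "pt S r u v"
  shows "pt S r (\<lambda>a. Cell (w a) (u a)) (\<lambda>a. Cell (w a) (v a))"
proof -
  have 1: "pt S r (\<lambda>a. Cell (x a) (y a)) (\<lambda>a. Cell (y a) (x a))" for x y
    by (rule pt_expr[where e = "Cons (Right (Var 0)) (Left (Var 0))"]) simp
  show ?thesis
    by (rule pt_comp[OF pt_comp[OF 1 pt_first[OF assms]] 1])
qed

lemma pt_Cell:
  assumes "pt S r u v" "pt S r u w"
  shows "pt S r u (\<lambda>a. Cell (v a) (w a))"
  by (rule pt_let[OF assms(1)]) (rule pt_second[OF assms(2)])

text \<open>Each branch has to be correct only on the ghosts that reach it, so the outcome of the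
  test becomes a hypothesis of the branch.\<close>

lemma pt_if:
  assumes "pt {a\<in>S. eval_expr e (init (u a)) \<noteq> Num 0} r u v"
    and "pt {a\<in>S. eval_expr e (init (u a)) = Num 0} r u v"
  shows "pt S r u v"
proof -
  let ?b = "\<lambda>a. r a + vsize (u a)"
  obtain c T where c: "\<And>a. a \<in> S \<Longrightarrow> eval_expr e (init (u a)) \<noteq> Num 0 \<Longrightarrow>
      exec c (init (u a)) (T a) (init (v a))"
    and "poly_bounded {a\<in>S. eval_expr e (init (u a)) \<noteq> Num 0} T ?b"
    using assms(1) by (rule ptE) blast
  moreover obtain d T' where d: "\<And>a. a \<in> S \<Longrightarrow> eval_expr e (init (u a)) = Num 0 \<Longrightarrow>
      exec d (init (u a)) (T' a) (init (v a))"
    and "poly_bounded {a\<in>S. eval_expr e (init (u a)) = Num 0} T' ?b"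
    using assms(2) by (rule ptE) blast
  ultimately obtain k l
    where k: "\<And>a. a \<in> S \<Longrightarrow> eval_expr e (init (u a)) \<noteq> Num 0 \<Longrightarrow> T a \<le> (?b a + 2) ^ k"
      and l: "\<And>a. a \<in> S \<Longrightarrow> eval_expr e (init (u a)) = Num 0 \<Longrightarrow> T' a \<le> (?b a + 2) ^ l"
    unfolding poly_bounded_def by blast
  define T'' where "T'' = (\<lambda>a. if eval_expr e (init (u a)) \<noteq> Num 0 then T a else T' a)"
  have "poly_bounded S T'' ?b"
  proof (rule poly_boundedI)
    fix a assume "a \<in> S"
    moreover have "(?b a + 2) ^ k \<le> (?b a + 2) ^ max k l" "(?b a + 2) ^ l \<le> (?b a + 2) ^ max k l"
      by (rule power_increasing; simp)+
    ultimately show "T'' a \<le> (?b a + 2) ^ max k l"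
      using order_trans[OF k[of a]] order_trans[OF l[of a]] unfolding T''_def by (cases "eval_expr e (init (u a)) = Num 0") simp_all
  qed
  moreover have "poly_bounded S (\<lambda>a. expr_cost e (init (u a))) ?b"
    by (rule poly_bounded_trans[OF poly_bounded_subst[OF expr_cost_poly_bounded]])
      (auto intro: poly_bounded_le)
  ultimately have "poly_bounded S (\<lambda>a. 1 + expr_cost e (init (u a)) + T'' a) ?b"
    by (intro poly_bounded_add poly_bounded_const)
  then show ?thesis
    by (intro ptI[where c = "If e c d"]) (use exec.IfTrue[OF _ c] exec.IfFalse[OF _ d] in \<open>auto simp: T''_def\<close>)
qed

text \<open>The resource is invariant and bounds the size of every reachable state
  (\<open>size\<close>), so all iterations obey one common time bound; chaining a separate
  polynomial bound per iteration would give no polynomial. \<open>rank\<close> bounds the number of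
  iterations, and \<open>v\<close> is the final value as predicted from any state of the
  loop.\<close>

lemma pt_while:
  assumes body: "pt {a\<in>S. b a} r u (\<lambda>a. u (step a))"
    and guard: "\<And>a. a \<in> S \<Longrightarrow> eval_expr e (init (u a)) \<noteq> Num 0 \<longleftrightarrow> b a"
    and step: "\<And>a. a \<in> S \<Longrightarrow> b a \<Longrightarrow> step a \<in> S"
      "\<And>a. a \<in> S \<Longrightarrow> b a \<Longrightarrow> r (step a) = r a"
      "\<And>a. a \<in> S \<Longrightarrow> b a \<Longrightarrow> rank (step a) < rank a"
      "\<And>a. a \<in> S \<Longrightarrow> b a \<Longrightarrow> v (step a) = v a"
    and stop: "\<And>a. a \<in> S \<Longrightarrow> \<not> b a \<Longrightarrow> v a = u a"
    and size: "poly_bounded S (\<lambda>a. vsize (u a)) r"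
    and rank: "poly_bounded S rank (\<lambda>a. r a + vsize (u a))"
  shows "pt S r u v"
proof -
  obtain c T where c: "\<And>a. a \<in> S \<Longrightarrow> b a \<Longrightarrow> exec c (init (u a)) (T a) (init (u (step a)))"
    and "poly_bounded {a\<in>S. b a} T (\<lambda>a. r a + vsize (u a))"
    using body by (rule ptE) blast
  moreover have "poly_bounded S (\<lambda>a. r a + vsize (u a)) r"
    by (rule poly_bounded_add[OF poly_bounded_le size]) simp
  ultimately have T: "poly_bounded {a\<in>S. b a} T r"
    by (auto intro: poly_bounded_trans poly_bounded_subset)
  have cost: "poly_bounded S (\<lambda>a. expr_cost e (init (u a))) r"
    by (rule poly_bounded_trans[OF poly_bounded_subst[OF expr_cost_poly_bounded]])
      (use size in simp_all)
  have "poly_bounded {a\<in>S. b a} (\<lambda>a. 1 + expr_cost e (init (u a)) + T a) r"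
    by (intro poly_bounded_add poly_bounded_const poly_bounded_subset[OF cost] T) auto
  then obtain k where k: "\<And>a. a \<in> S \<Longrightarrow> b a \<Longrightarrow>
      1 + expr_cost e (init (u a)) + T a \<le> (r a + 2) ^ k"
    unfolding poly_bounded_def by blast
  have "poly_bounded S (\<lambda>a. 1 + expr_cost e (init (u a))) r"
    using cost by (intro poly_bounded_add poly_bounded_const)
  then obtain l where l: "\<And>a. a \<in> S \<Longrightarrow> 1 + expr_cost e (init (u a)) \<le> (r a + 2) ^ l"
    unfolding poly_bounded_def by blast
  \<comment> \<open>At most \<open>rank a\<close> iterations and one closing test; \<open>k\<close>
    bounds an iteration, \<open>l\<close> the test, and every one of the \<open>rank a + 1\<close>
    rounds is charged with both.\<close>
  have ex: "\<exists>t. exec (While e c) (init (u a)) t (init (v a)) \<and>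
      t \<le> (rank a + 1) * ((r a + 2) ^ k + (r a + 2) ^ l)" if "a \<in> S" for a
    using that
  proof (induction "rank a" arbitrary: a rule: less_induct)
    case less
    let ?Q = "(r a + 2) ^ k + (r a + 2) ^ l"
    show ?case
    proof (cases "b a")
      case True
      obtain t where t: "exec (While e c) (init (u (step a))) t (init (v (step a)))"
        and le: "t \<le> (rank (step a) + 1) * ?Q"
        using less.hyps[OF step(3) step(1)] less.prems True step(2)[of a] by auto
      have "exec (While e c) (init (u a)) (1 + expr_cost e (init (u a)) + T a + t) (init (v a))"
        using exec.WhileTrue[OF _ c t] guard less.prems True step(4) by simp
      moreover have "1 + expr_cost e (init (u a)) + T a + t \<le> (rank a + 1) * ?Q"
      proof -
        have "1 + expr_cost e (init (u a)) + T a + t \<le> ?Q + (rank (step a) + 1) * ?Q"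
          using k[OF less.prems True] le by linarith
        also have "\<dots> = (rank (step a) + 2) * ?Q" by simp
        also have "\<dots> \<le> (rank a + 1) * ?Q"
          using step(3)[OF less.prems True] by (intro mult_right_mono) auto
        finally show ?thesis .
      qed
      ultimately show ?thesis by blast
    next
      case False
      have "exec (While e c) (init (u a)) (1 + expr_cost e (init (u a))) (init (v a))"
        using exec.WhileFalse[of e "init (u a)" c] guard[OF less.prems] stop[OF less.prems] False
        by simp
      moreover have "1 + expr_cost e (init (u a)) \<le> (rank a + 1) * ?Q"
        using l[OF less.prems] by (simp add: add.commute trans_le_add1)
      ultimately show ?thesis by blast
    qed
  qed
  then obtain T' where T': "\<And>a. a \<in> S \<Longrightarrow> exec (While e c) (init (u a)) (T' a) (init (v a))"
    "\<And>a. a \<in> S \<Longrightarrow> T' a \<le> (rank a + 1) * ((r a + 2) ^ k + (r a + 2) ^ l)"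
    by metis
  have pow: "poly_bounded S (\<lambda>a. (r a + 2) ^ j) (\<lambda>a. r a + vsize (u a))" for j
    by (rule poly_boundedI[where k = j]) (simp add: power_mono)
  have "poly_bounded S (\<lambda>a. (rank a + 1) * ((r a + 2) ^ k + (r a + 2) ^ l))
      (\<lambda>a. r a + vsize (u a))"
    by (intro poly_bounded_mult poly_bounded_add poly_bounded_const rank pow)
  then have "poly_bounded S T' (\<lambda>a. r a + vsize (u a))"
    by (rule poly_bounded_mono) (rule T'(2))
  with T'(1) show ?thesis by (rule ptI)
qed

section \<open>Loops over encoded lists\<close>

lemma vsize_vlist: "vsize (vlist xs) = 1 + (\<Sum>x\<leftarrow>xs. 1 + vsize x)"
  by (induction xs) (auto simp: floorlog_def)

lemma vlist_eq_Cell_iff: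
  "(\<exists>x y. vlist xs = Cell x y) \<longleftrightarrow> xs \<noteq> []"
  "(\<forall>x y. vlist xs \<noteq> Cell x y) \<longleftrightarrow> xs = []"
  by (cases xs; simp)+

text \<open>\<open>ctx\<close> is the part of the state that the loop body may read but must preserve.\<close>

lemma pt_fold:
  fixes el :: "'a \<Rightarrow> 'b \<Rightarrow> val" and st :: "'a \<Rightarrow> 's \<Rightarrow> val"
  assumes body: "pt {(a, b, s). a \<in> S \<and> (\<exists>ys zs. ls a = ys @ b # zs \<and> s = fold (h a) ys (s0 a))}
      (\<lambda>(a, b, s). r a) (\<lambda>(a, b, s). Cell (el a b) (Cell (ctx a) (st a s)))
      (\<lambda>(a, b, s). st a (h a b s))"
    and size: "poly_bounded {(a, ys). a \<in> S \<and> (\<exists>zs. ls a = ys @ zs)}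
      (\<lambda>(a, ys). vsize (st a (fold (h a) ys (s0 a))))
      (\<lambda>(a, ys). r a + vsize (vlist (map (el a) (ls a))) + vsize (ctx a) + vsize (st a (s0 a)))"
  shows "pt S r (\<lambda>a. Cell (vlist (map (el a) (ls a))) (Cell (ctx a) (st a (s0 a))))
    (\<lambda>a. st a (fold (h a) (ls a) (s0 a)))"
proof -
  let ?in = "\<lambda>a. Cell (vlist (map (el a) (ls a))) (Cell (ctx a) (st a (s0 a)))"
  define S' where "S' = {(a, ys, zs). a \<in> S \<and> ls a = ys @ zs}"
  \<comment> \<open>Freezes the size of the initial configuration: the list still to be read
    shrinks, whereas \<open>pt_while\<close> demands an invariant resource. In the ghost triples,
    \<open>ys\<close> is processed and \<open>zs\<close> is pending.\<close>
  define R where "R = (\<lambda>(a, ys :: 'b list, zs :: 'b list). r a + vsize (?in a))"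
  define u where "u = (\<lambda>(a, ys, zs).
    Cell (vlist (map (el a) zs)) (Cell (ctx a) (st a (fold (h a) ys (s0 a)))))"
  define v where "v = (\<lambda>(a, ys :: 'b list, zs :: 'b list).
    Cell (Num 0) (Cell (ctx a) (st a (fold (h a) (ls a) (s0 a)))))"
  define b where "b = (\<lambda>(a :: 'a, ys :: 'b list, zs :: 'b list). zs \<noteq> [])"
  define step where "step = (\<lambda>(a :: 'a, ys :: 'b list, zs). (a, ys @ [hd zs], tl zs))"
  have loop: "pt S' R u v"
  proof (rule pt_while[where step = step and b = b and e = "IsCell (Left (Var 0))"
        and rank = "\<lambda>(a, ys, zs). length zs"])
    show "pt {a \<in> S'. b a} R u (\<lambda>a. u (step a))"
    proof -
      let ?D = "{a \<in> S'. b a}"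
      let ?f = "\<lambda>(a, ys, zs). fold (h a) ys (s0 a)"
      have 1: "pt ?D R u (\<lambda>(a, ys, zs). Cell
          (Cell (el a (hd zs)) (Cell (ctx a) (st a (fold (h a) ys (s0 a)))))
          (Cell (vlist (map (el a) (tl zs))) (ctx a)))"
        by (rule pt_expr[where e = "Cons (Cons (Left (Left (Var 0))) (Right (Var 0)))
              (Cons (Right (Left (Var 0))) (Left (Right (Var 0))))"])
          (auto simp: S'_def b_def u_def neq_Nil_conv)
      have "pt ?D (\<lambda>(a, ys, zs). r a) (\<lambda>(a, ys, zs).
            Cell (el a (hd zs)) (Cell (ctx a) (st a (fold (h a) ys (s0 a)))))
          (\<lambda>(a, ys, zs). st a (h a (hd zs) (fold (h a) ys (s0 a))))"
        by (rule pt_subst[OF body, where h = "\<lambda>(a, ys, zs). (a, hd zs, fold (h a) ys (s0 a))"])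
          (auto simp: S'_def b_def neq_Nil_conv, blast)
      then have "pt ?D R (\<lambda>(a, ys, zs).
            Cell (el a (hd zs)) (Cell (ctx a) (st a (fold (h a) ys (s0 a)))))
          (\<lambda>(a, ys, zs). st a (h a (hd zs) (fold (h a) ys (s0 a))))"
        by (rule pt_resource) (auto simp: R_def intro!: poly_bounded_le)
      from pt_first[OF this, where w = "\<lambda>(a, ys, zs). Cell (vlist (map (el a) (tl zs))) (ctx a)"]
      have 2: "pt ?D R (\<lambda>(a, ys, zs). Cell
          (Cell (el a (hd zs)) (Cell (ctx a) (st a (fold (h a) ys (s0 a)))))
          (Cell (vlist (map (el a) (tl zs))) (ctx a)))
        (\<lambda>(a, ys, zs). Cell (st a (h a (hd zs) (fold (h a) ys (s0 a))))
          (Cell (vlist (map (el a) (tl zs))) (ctx a)))"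
        by (rule pt_cong) auto
      have 3: "pt ?D R (\<lambda>(a, ys, zs). Cell (st a (h a (hd zs) (fold (h a) ys (s0 a))))
          (Cell (vlist (map (el a) (tl zs))) (ctx a))) (\<lambda>a. u (step a))"
        by (rule pt_expr[where e = "Cons (Left (Right (Var 0)))
              (Cons (Right (Right (Var 0))) (Left (Var 0)))"])
          (auto simp: u_def step_def)
      show ?thesis by (rule pt_comp[OF pt_comp[OF 1 2] 3])
    qed
    obtain k where k: "\<forall>z\<in>{(a, ys). a \<in> S \<and> (\<exists>zs. ls a = ys @ zs)}.
        (case z of (a, ys) \<Rightarrow> vsize (st a (fold (h a) ys (s0 a)))) \<le> ((case z of (a, ys) \<Rightarrow>
          r a + vsize (vlist (map (el a) (ls a))) + vsize (ctx a) + vsize (st a (s0 a))) + 2) ^ k"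
      using size unfolding poly_bounded_def by blast
    have "poly_bounded S' (\<lambda>(a, ys, zs). vsize (st a (fold (h a) ys (s0 a)))) R"
    proof (rule poly_boundedI[where k = k])
      fix z assume "z \<in> S'"
      then obtain a ys zs where z: "z = (a, ys, zs)" "a \<in> S" "ls a = ys @ zs"
        by (auto simp: S'_def)
      have "(r a + vsize (vlist (map (el a) (ls a))) + vsize (ctx a) + vsize (st a (s0 a)) + 2) ^ k
          \<le> (R z + 2) ^ k"
        by (rule power_mono) (auto simp: R_def z)
      moreover have "vsize (st a (fold (h a) ys (s0 a)))
          \<le> (r a + vsize (vlist (map (el a) (ls a))) + vsize (ctx a) + vsize (st a (s0 a)) + 2) ^ k"
        using bspec[OF k, of "(a, ys)"] z by (simp only: mem_Collect_eq prod.case) blast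
      ultimately show "(case z of (a, ys, zs) \<Rightarrow> vsize (st a (fold (h a) ys (s0 a))))
          \<le> (R z + 2) ^ k"
        unfolding z(1) prod.case by (rule order_trans[rotated])
    qed
    then have "poly_bounded S' (\<lambda>z. (case z of (a, ys, zs) \<Rightarrow> vsize (st a (fold (h a) ys (s0 a)))) +
        (R z + R z + 2)) R"
      by (rule poly_bounded_add) (intro poly_bounded_add poly_bounded_const poly_bounded_le; simp)
    then show "poly_bounded S' (\<lambda>a. vsize (u a)) R"
      by (rule poly_bounded_mono) (auto simp: S'_def R_def u_def vsize_vlist)
    show "poly_bounded S' (\<lambda>(a, ys, zs). length zs) (\<lambda>a. R a + vsize (u a))"
    proof (rule poly_bounded_le)
      fix z assume "z \<in> S'"
      have "length xs \<le> vsize (vlist xs)" for xs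
        by (induction xs) auto
      then have "length zs \<le> vsize (vlist (map (el a) zs))" for a zs
        by (metis length_map)
      moreover have "vsize (vlist (map (el a) zs)) \<le> vsize (u (a, ys, zs))" for a ys zs
        by (simp add: u_def)
      ultimately show "(case z of (a, ys, zs) \<Rightarrow> length zs) \<le> R z + vsize (u z)"
        by (cases z) (simp, meson order_trans trans_le_add2)
    qed
  qed (auto simp: S'_def R_def u_def v_def b_def step_def truth_def vlist_eq_Cell_iff)
  have "pt S (\<lambda>a. r a + vsize (?in a)) ?in
      (\<lambda>a. Cell (Num 0) (Cell (ctx a) (st a (fold (h a) (ls a) (s0 a)))))"
    by (rule pt_subst[OF loop, where h = "\<lambda>a. (a, [], ls a)"])
      (auto simp: S'_def R_def u_def v_def)
  then have "pt S r ?in (\<lambda>a. Cell (Num 0) (Cell (ctx a) (st a (fold (h a) (ls a) (s0 a)))))"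
    by (rule pt_resource) (intro poly_bounded_add poly_bounded_le; simp)
  then show ?thesis
    by (rule pt_comp) (rule pt_expr[where e = "Right (Right (Var 0))"], simp)
qed

text \<open>Results are pushed onto an accumulator, hence the reversal. In contrast to
  \<open>pt_fold\<close> no size hypothesis appears: every element is processed independently of the
  others, so the sizes of the outputs merely add up.\<close>

lemma pt_map:
  fixes el out :: "'a \<Rightarrow> 'b \<Rightarrow> val"
  assumes body: "pt {(a, b). a \<in> S \<and> b \<in> set (ls a)}
      (\<lambda>(a, b). r a) (\<lambda>(a, b). Cell (el a b) (ctx a)) (\<lambda>(a, b). out a b)"
  shows "pt S r (\<lambda>a. Cell (vlist (map (el a) (ls a))) (Cell (ctx a) (vlist (acc a))))
    (\<lambda>a. vlist (rev (map (out a) (ls a)) @ acc a))"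
proof -
  have fold: "fold (\<lambda>b. (#) (out a b)) ys s = rev (map (out a) ys) @ s" for a ys s
    by (induction ys arbitrary: s) auto
  have "pt S r (\<lambda>a. Cell (vlist (map (el a) (ls a))) (Cell (ctx a) (vlist (acc a))))
      (\<lambda>a. vlist (fold (\<lambda>b. (#) (out a b)) (ls a) (acc a)))"
  proof (rule pt_fold)
    let ?D = "{(a, b, s). a \<in> S \<and> (\<exists>ys zs. ls a = ys @ b # zs \<and>
        s = fold (\<lambda>b. (#) (out a b)) ys (acc a))}"
    have 1: "pt ?D (\<lambda>(a, b, s). r a) (\<lambda>(a, b, s). Cell (el a b) (ctx a)) (\<lambda>(a, b, s). out a b)"
      by (rule pt_subst[OF body, where h = "\<lambda>(a, b, s). (a, b)"]) auto
    have 2: "pt ?D (\<lambda>(a, b, s). r a) (\<lambda>(a, b, s). Cell (el a b) (Cell (ctx a) (vlist s)))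
        (\<lambda>(a, b, s). Cell (Cell (el a b) (ctx a)) (vlist s))"
      by (rule pt_expr[where e = "Cons (Cons (Left (Var 0)) (Left (Right (Var 0))))
            (Right (Right (Var 0)))"]) auto
    have 3: "pt ?D (\<lambda>(a, b, s). r a) (\<lambda>(a, b, s). Cell (Cell (el a b) (ctx a)) (vlist s))
        (\<lambda>(a, b, s). vlist (out a b # s))"
      by (rule pt_cong[OF pt_first[OF 1, where w = "\<lambda>(a, b, s). vlist s"]]) auto
    show "pt ?D (\<lambda>(a, b, s). r a) (\<lambda>(a, b, s). Cell (el a b) (Cell (ctx a) (vlist s)))
        (\<lambda>(a, b, s). vlist (out a b # s))"
      by (rule pt_comp[OF 2 3])
  next
    let ?D = "{(a, ys). a \<in> S \<and> (\<exists>zs. ls a = ys @ zs)}"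
    let ?b = "\<lambda>(a, ys). r a + vsize (vlist (map (el a) (ls a))) + vsize (ctx a) + vsize (vlist (acc a))"
    obtain k where k: "\<And>a b. a \<in> S \<Longrightarrow> b \<in> set (ls a) \<Longrightarrow>
        vsize (out a b) \<le> (r a + vsize (Cell (el a b) (ctx a)) + 2) ^ k"
      using pt_output_size[OF body] unfolding poly_bounded_def by auto
    \<comment> \<open>Accumulator, plus at most \<open>?b z\<close> elements whose outputs are
      bounded by the power. The extra 1 in its base is the \<open>Cell\<close> joining element and
      context.\<close>
    have "poly_bounded ?D (\<lambda>z. ?b z + ?b z * (1 + (?b z + 1 + 2) ^ k)) ?b"
    proof (intro poly_bounded_add poly_bounded_mult poly_bounded_const)
      have "poly_bounded ?D (\<lambda>z. (?b z + 1 + 2) ^ k) (\<lambda>z. ?b z + 1)"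
        by (rule poly_boundedI[where k = k]) simp
      then have "poly_bounded ?D (\<lambda>z. (?b z + 1 + 2) ^ k) ?b"
        by (rule poly_bounded_trans)
          (intro poly_bounded_add poly_bounded_const poly_bounded_le; simp)
      then show "poly_bounded ?D (\<lambda>z. (?b z + 1 + 2) ^ k) ?b" .
    qed (rule poly_bounded_le, simp)+
    then show "poly_bounded ?D
        (\<lambda>(a, ys). vsize (vlist (fold (\<lambda>b. (#) (out a b)) ys (acc a)))) ?b"
    proof (rule poly_bounded_mono)
      fix z assume z: "z \<in> ?D"
      obtain a ys zs where [simp]: "z = (a, ys)" and a: "a \<in> S" and ls: "ls a = ys @ zs"
        using z by auto
      have el: "vsize (el a b) \<le> vsize (vlist (map (el a) xs))" if "b \<in> set xs" for b xs
        using that by (induction xs) auto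
      have len: "length xs \<le> vsize (vlist (map (el a) xs))" for xs
        by (induction xs) auto
      have sum: "(\<Sum>x\<leftarrow>map g xs. 1 + vsize x) \<le> length xs * (1 + M)"
        if "\<And>b. b \<in> set xs \<Longrightarrow> vsize (g b) \<le> M" for g :: "'b \<Rightarrow> val" and xs M
        using that
      proof (induction xs)
        case (Cons x xs)
        then have "(\<Sum>x\<leftarrow>map g xs. 1 + vsize x) \<le> length xs * (1 + M)" "vsize (g x) \<le> M"
          by simp_all
        then show ?case by simp
      qed simp
      have out: "vsize (out a b) \<le> (?b z + 1 + 2) ^ k" if "b \<in> set ys" for b
      proof -
        have "b \<in> set (ls a)" using that ls by simp
        then have "vsize (out a b) \<le> (r a + vsize (Cell (el a b) (ctx a)) + 2) ^ k"
          using k a by blast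
        also have "\<dots> \<le> (?b z + 1 + 2) ^ k"
          using el[OF \<open>b \<in> set (ls a)\<close>] by (intro power_mono) auto
        finally show ?thesis .
      qed
      have "(\<Sum>x\<leftarrow>map (out a) ys. 1 + vsize x) \<le> length ys * (1 + (?b z + 1 + 2) ^ k)"
        using sum[OF out] .
      also have "\<dots> \<le> ?b z * (1 + (?b z + 1 + 2) ^ k)"
        using len[of "ls a"] ls by (intro mult_right_mono) auto
      finally have "(\<Sum>x\<leftarrow>map (out a) ys. 1 + vsize x) \<le> ?b z * (1 + (?b z + 1 + 2) ^ k)" .
      moreover have "vsize (vlist (rev (map (out a) ys) @ acc a)) =
          (\<Sum>x\<leftarrow>map (out a) ys. 1 + vsize x) + vsize (vlist (acc a))"
        by (simp add: vsize_vlist rev_map[symmetric] sum_list_rev flip: rev_map)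
      ultimately show "(case z of (a, ys) \<Rightarrow> vsize (vlist (fold (\<lambda>b. (#) (out a b)) ys (acc a))))
          \<le> ?b z + ?b z * (1 + (?b z + 1 + 2) ^ k)"
        by (simp only: fold prod.case \<open>z = (a, ys)\<close>)
    qed
  qed
  then show ?thesis by (simp only: fold)
qed

lemma pt_rev: "pt S r (\<lambda>a. vlist (ls a)) (\<lambda>a. vlist (rev (ls a)))"
proof -
  have "pt {(a, b). a \<in> S \<and> b \<in> set (ls a)} (\<lambda>(a, b). r a) (\<lambda>(a, b). Cell b (Num 0)) (\<lambda>(a, b). b)"
    by (rule pt_expr[where e = "Left (Var 0)"]) auto
  from pt_map[OF this, where acc = "\<lambda>_. []"]
  have "pt S r (\<lambda>a. Cell (vlist (ls a)) (Cell (Num 0) (Num 0))) (\<lambda>a. vlist (rev (ls a)))"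
    by simp
  then show ?thesis
    by (rule pt_comp[rotated])
      (rule pt_expr[where e = "Cons (Var 0) (Cons (Const 0) (Const 0))"], simp)
qed


section \<open>Cost values and arc restrictions\<close>

definition cost_values :: "network \<Rightarrow> cost \<Rightarrow> rat set" where
  "cost_values N c = flow_cost N c ` {f. feasible N f}"

definition arc_indicator :: "nat \<times> nat \<Rightarrow> cost" where
  "arc_indicator a = (\<lambda>b. if b = a then 1 else 0)"

definition min_flow :: "network \<Rightarrow> nat \<times> nat \<Rightarrow> int" where
  "min_flow N a = Min ((\<lambda>f. f a) ` {f. feasible N f})"

definition restrict_arc :: "network \<Rightarrow> nat \<times> nat \<Rightarrow> int \<Rightarrow> int \<Rightarrow> network" where
  "restrict_arc N a l h = N\<lparr>lower := (lower N)(a := l), upper := (upper N)(a := h)\<rparr>"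

lemma restrict_arc_simps [simp]:
  "digraph (restrict_arc N a l h) = digraph N"
  "balance (restrict_arc N a l h) = balance N"
  "lower (restrict_arc N a l h) = (lower N)(a := l)"
  "upper (restrict_arc N a l h) = (upper N)(a := h)"
  by (simp_all add: restrict_arc_def)

lemma finite_arcs: "valid_network N \<Longrightarrow> finite (arcs_of N)"
  by (auto simp: valid_network_def dest: pair_fin_digraph.pair_finite_arcs)

text \<open>The set of feasible functions is infinite, as values off the arcs are free; but costs
  depend only on the restriction to the arcs, which lies in a finite integer box.\<close>

lemma finite_cost_values:
  assumes "valid_network N"
  shows "finite (cost_values N c)"
proof -
  let ?P = "PiE (arcs_of N) (\<lambda>a. {lower N a..upper N a})"
  have "finite ?P" using finite_arcs[OF assms] by (intro finite_PiE) auto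
  moreover have "cost_values N c \<subseteq> flow_cost N c ` ?P"
  proof
    fix q assume "q \<in> cost_values N c"
    then obtain f where f: "feasible N f" "q = flow_cost N c f" by (auto simp: cost_values_def)
    have "restrict f (arcs_of N) \<in> ?P" using f(1) by (auto simp: feasible_def)
    moreover have "q = flow_cost N c (restrict f (arcs_of N))"
      unfolding f(2) flow_cost_def by (intro sum.cong) auto
    ultimately show "q \<in> flow_cost N c ` ?P" by blast
  qed
  ultimately show ?thesis by (meson finite_imageI finite_subset)
qed

lemma supported_nondominated_opposite:
  "supported_nondominated (N, c, \<lambda>a. - c a) = (\<lambda>q. (q, - q)) ` cost_values N c"
proof -
  have neg: "flow_cost N (\<lambda>a. - c a) f = - flow_cost N c f" for f
    by (simp add: flow_cost_def sum_negf)
  have "weighted_sum 1 1 (q, - q) = 0" for q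
    by (simp add: weighted_sum_def of_rat_minus)
  then have "supported (N, c, \<lambda>a. - c a) (flow_cost N c f, - flow_cost N c f)"
    if "feasible N f" for f
    unfolding supported_def using that
    by (intro exI[of _ f] exI[of _ 1]) (simp add: neg)
  then show ?thesis
    unfolding supported_nondominated_def cost_values_def nondominated_def vec_le_def
    by (auto simp: neg)
qed

lemma card_opposite_image:
  "card ((\<lambda>q. (q, - q)) ` A) = card (A :: rat set)"
  by (rule card_image) (auto simp: inj_on_def)

lemma min_flow:
  assumes "valid_network N" "a \<in> arcs_of N"
  shows "\<exists>f. feasible N f \<and> f a = min_flow N a" "feasible N f \<Longrightarrow> min_flow N a \<le> f a"
proof -
  have "(\<lambda>f. f a) ` {f. feasible N f} \<subseteq> {lower N a..upper N a}"
    using assms(2) by (auto simp: feasible_def)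
  then have fin: "finite ((\<lambda>f. f a) ` {f. feasible N f})"
    by (rule finite_subset) simp
  have "(\<lambda>f. f a) ` {f. feasible N f} \<noteq> {}"
    using assms(1) by (auto simp: valid_network_def)
  from Min_in[OF fin this] show "\<exists>f. feasible N f \<and> f a = min_flow N a"
    unfolding min_flow_def by force
  show "feasible N f \<Longrightarrow> min_flow N a \<le> f a"
    unfolding min_flow_def using fin by (intro Min_le) auto
qed

lemma min_flow_bounds:
  assumes "valid_network N" "a \<in> arcs_of N"
  shows "lower N a \<le> min_flow N a" "min_flow N a \<le> upper N a"
  using min_flow(1)[OF assms] assms(2) by (auto simp: feasible_def)

text \<open>With two equal costs all images lie on the diagonal, where the Pareto order is total. So
  only the minimum is nondominated, and the weights (1, 1) support it.\<close>

lemma supported_nondominated_arc_indicator: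
  assumes "valid_network N" "a \<in> arcs_of N"
  shows "supported_nondominated (N, arc_indicator a, arc_indicator a) =
    {(of_int (min_flow N a), of_int (min_flow N a))}"
proof -
  have cost: "flow_cost N (arc_indicator a) f = of_int (f a)" for f
  proof -
    have "flow_cost N (arc_indicator a) f = (\<Sum>b\<in>arcs_of N. if b = a then of_int (f b) else 0)"
      unfolding flow_cost_def arc_indicator_def by (intro sum.cong) auto
    then show ?thesis using finite_arcs[OF assms(1)] assms(2) by simp
  qed
  obtain g where g: "feasible N g" "g a = min_flow N a"
    using min_flow(1)[OF assms] by blast
  let ?I = "(N, arc_indicator a, arc_indicator a)" and ?m = "of_int (min_flow N a) :: rat"
  have "supported_nondominated ?I \<subseteq> {(?m, ?m)}"
  proof
    fix v assume "v \<in> supported_nondominated ?I"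
    then have v: "nondominated ?I v" by (simp add: supported_nondominated_def)
    then obtain f where f: "feasible N f" "v = (of_int (f a), of_int (f a))"
      by (auto simp: nondominated_def cost)
    have "\<not> (vec_le (cost_vector ?I g) v \<and> cost_vector ?I g \<noteq> v)"
      using v g(1) by (auto simp: nondominated_def)
    then show "v \<in> {(?m, ?m)}"
      using min_flow(2)[OF assms f(1)] f(2) g(2) by (auto simp: vec_le_def cost)
  qed
  moreover have "nondominated ?I (?m, ?m)"
    unfolding nondominated_def using g
    by (auto simp: cost vec_le_def dest: min_flow(2)[OF assms] intro!: exI[of _ g])
  moreover have "supported ?I (?m, ?m)"
  proof -
    have "weighted_sum 1 1 (cost_vector ?I g) \<le> weighted_sum 1 1 (cost_vector ?I f)"
      if "feasible N f" for f
      using min_flow(2)[OF assms that] g(2) by (simp add: weighted_sum_def cost)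
    then show ?thesis
      unfolding supported_def using g
      by (intro exI[of _ g] exI[of _ 1]) (simp add: cost)
  qed
  ultimately show ?thesis by (auto simp: supported_nondominated_def)
qed

lemma feasible_restrict_arc:
  assumes "a \<in> arcs_of N" "lower N a \<le> l" "h \<le> upper N a"
  shows "feasible (restrict_arc N a l h) f \<longleftrightarrow> feasible N f \<and> l \<le> f a \<and> f a \<le> h"
proof -
  have "(\<forall>b\<in>arcs_of N. ((lower N)(a := l)) b \<le> f b \<and> f b \<le> ((upper N)(a := h)) b) \<longleftrightarrow>
      (\<forall>b\<in>arcs_of N. lower N b \<le> f b \<and> f b \<le> upper N b) \<and> l \<le> f a \<and> f a \<le> h"
  proof -
    have "((lower N)(a := l)) b \<le> f b \<and> f b \<le> ((upper N)(a := h)) b \<longleftrightarrow>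
        (lower N b \<le> f b \<and> f b \<le> upper N b)" if "b \<noteq> a" for b
      using that by simp
    moreover have "l \<le> f a \<and> f a \<le> h \<Longrightarrow> lower N a \<le> f a \<and> f a \<le> upper N a"
      using assms(2,3) by linarith
    ultimately show ?thesis using assms(1) by (metis fun_upd_same)
  qed
  then show ?thesis by (simp only: feasible_def restrict_arc_simps) blast
qed

lemma flow_cost_restrict_arc [simp]: "flow_cost (restrict_arc N a l h) = flow_cost N"
  by (auto simp: flow_cost_def fun_eq_iff)

text \<open>The flow \<open>f\<close> through the new interval witnesses feasibility and also
  \<open>l \<le> h\<close>.\<close>

lemma valid_restrict_arc:
  assumes "valid_network N" "a \<in> arcs_of N" "lower N a \<le> l" "h \<le> upper N a"
    and "feasible N f" "l \<le> f a" "f a \<le> h"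
  shows "valid_network (restrict_arc N a l h)"
proof -
  have "feasible (restrict_arc N a l h) f" using assms by (simp add: feasible_restrict_arc)
  moreover have "\<forall>b\<in>arcs_of N. 0 \<le> (if b = a then l else lower N b) \<and>
      (if b = a then l else lower N b) \<le> (if b = a then h else upper N b)"
    using assms by (fastforce simp: valid_network_def)
  ultimately show ?thesis
    using assms(1) by (auto simp: valid_network_def)
qed


section \<open>Bisection towards a flow of prescribed cost\<close>

text \<open>Raising the lower capacity to the minimum flow on the arc keeps the lower half feasible.\<close>

definition lower_half :: "network \<Rightarrow> nat \<times> nat \<Rightarrow> network" where
  "lower_half N a = restrict_arc N a (min_flow N a) ((min_flow N a + upper N a) div 2)"

definition upper_half :: "network \<Rightarrow> nat \<times> nat \<Rightarrow> network" where
  "upper_half N a = restrict_arc N a ((min_flow N a + upper N a) div 2 + 1) (upper N a)"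

text \<open>Only the lower half is ever queried. The upper half may be infeasible in general, but it
  is entered only after the query has failed, and then all flows of cost \<open>q\<close> lie in
  it.\<close>

definition halve :: "cost \<Rightarrow> rat \<Rightarrow> network \<Rightarrow> nat \<times> nat \<Rightarrow> network" where
  "halve c q N a = (if q \<in> cost_values (lower_half N a) c then lower_half N a else upper_half N a)"

lemma valid_lower_half:
  assumes "valid_network N" "a \<in> arcs_of N"
  shows "valid_network (lower_half N a)"
proof -
  obtain f where "feasible N f" "f a = min_flow N a" using min_flow(1)[OF assms] by blast
  then show ?thesis
    unfolding lower_half_def using min_flow_bounds[OF assms]
    by (intro valid_restrict_arc[OF assms, of _ _ f]) auto
qed

lemma cost_values_lower_half:
  assumes "valid_network N" "a \<in> arcs_of N"
  shows "cost_values (lower_half N a) c \<subseteq> cost_values N c"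
proof -
  have "min_flow N a + upper N a \<le> 2 * upper N a" using min_flow_bounds[OF assms] by simp
  then have "(min_flow N a + upper N a) div 2 \<le> upper N a" by linarith
  then show ?thesis
    using feasible_restrict_arc[OF assms(2) min_flow_bounds(1)[OF assms]]
    by (auto simp: cost_values_def lower_half_def)
qed

lemma halve:
  assumes N: "valid_network N" and a: "a \<in> arcs_of N" and q: "q \<in> cost_values N c"
  defines "N' \<equiv> halve c q N a"
  shows "digraph N' = digraph N" "balance N' = balance N"
    "\<And>b. b \<noteq> a \<Longrightarrow> lower N' b = lower N b \<and> upper N' b = upper N b"
    "lower N a \<le> lower N' a" "upper N' a \<le> upper N a"
    "upper N' a - lower N' a \<le> (upper N a - lower N a) div 2"
    "\<And>f. feasible N' f \<Longrightarrow> feasible N f"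
    "valid_network N'" "q \<in> cost_values N' c"
proof -
  let ?m = "min_flow N a" and ?h = "(min_flow N a + upper N a) div 2"
  have m: "lower N a \<le> ?m" "?m \<le> upper N a" using min_flow_bounds[OF N a] .
  then have h: "?m \<le> ?h" "?h \<le> upper N a" by linarith+
  have "N' = lower_half N a \<or> N' = upper_half N a" by (simp add: N'_def halve_def)
  then consider "N' = restrict_arc N a ?m ?h" | "N' = restrict_arc N a (?h + 1) (upper N a)"
    by (auto simp: lower_half_def upper_half_def)
  note cases = this
  show "digraph N' = digraph N" "balance N' = balance N"
    "\<And>b. b \<noteq> a \<Longrightarrow> lower N' b = lower N b \<and> upper N' b = upper N b"
    using cases by fastforce+
  show "lower N a \<le> lower N' a" "upper N' a \<le> upper N a"
    using cases m h by fastforce+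
  \<comment> \<open>Rounding down the midpoint favours the lower half; the \<open>+ 1\<close> in the
    upper half compensates. Without it an interval of width 1 would not shrink.\<close>
  show "upper N' a - lower N' a \<le> (upper N a - lower N a) div 2"
    using m h by (cases rule: cases) auto
  show "feasible N f" if "feasible N' f" for f
    using that m h feasible_restrict_arc[OF a]
    by (cases rule: cases) (simp_all add: feasible_restrict_arc[OF a])
  show *: "q \<in> cost_values N' c"
  proof (cases "q \<in> cost_values (lower_half N a) c")
    case True
    then show ?thesis by (simp add: N'_def halve_def)
  next
    case False
    obtain f where f: "feasible N f" "q = flow_cost N c f" using q by (auto simp: cost_values_def)
    \<comment> \<open>A flow below the midpoint would meet the raised lower capacity too, by
      minimality of \<open>min_flow\<close>, and so contradict the failed query.\<close>
    have "\<not> f a \<le> ?h"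
    proof
      assume "f a \<le> ?h"
      then have "feasible (lower_half N a) f"
        using f(1) m h min_flow(2)[OF N a f(1)]
        by (simp add: lower_half_def feasible_restrict_arc[OF a])
      with False f(2) show False by (auto simp: cost_values_def lower_half_def)
    qed
    moreover have "f a \<le> upper N a" using f(1) a by (auto simp: feasible_def)
    ultimately have "feasible (upper_half N a) f"
      using f(1) m h by (simp add: upper_half_def feasible_restrict_arc[OF a])
    then show ?thesis
      using False f(2) by (auto simp: N'_def halve_def cost_values_def upper_half_def)
  qed
  obtain f where f: "feasible N' f" using * by (auto simp: cost_values_def)
  show "valid_network N'"
  proof (cases rule: cases)
    case 1
    then show ?thesis
      using f m h by (auto simp: feasible_restrict_arc[OF a] intro!: valid_restrict_arc[OF N a])
  next
    case 2
    then show ?thesis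
      using f m h by (auto simp: feasible_restrict_arc[OF a] intro!: valid_restrict_arc[OF N a])
  qed
qed

text \<open>Current network, arcs still to be fixed, arcs whose capacity interval is already a
  point.\<close>

type_synonym search_state = "network \<times> (nat \<times> nat) list \<times> (nat \<times> nat) list"

fun search_step :: "cost \<Rightarrow> rat \<Rightarrow> search_state \<Rightarrow> search_state" where
  "search_step c q (N, [], D) = (N, [], D)"
| "search_step c q (N, a # T, D) =
    (if lower N a < upper N a then (halve c q N a, a # T, D) else (N, T, a # D))"

text \<open>That \<open>q\<close> remains a cost value and that flows remain feasible for
  \<open>N0\<close> gives correctness; the comparison of capacities with those of \<open>N0\<close>
  keeps all numbers small, which is what \<open>search_code_size\<close> exploits.\<close>

definition search_inv :: "network \<Rightarrow> cost \<Rightarrow> rat \<Rightarrow> search_state \<Rightarrow> bool" where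
  "search_inv N0 c q = (\<lambda>(N, T, D).
    valid_network N \<and> digraph N = digraph N0 \<and> balance N = balance N0 \<and>
    distinct (T @ D) \<and> set (T @ D) = arcs_of N0 \<and> q \<in> cost_values N c \<and>
    (\<forall>f. feasible N f \<longrightarrow> feasible N0 f) \<and>
    (\<forall>a\<in>arcs_of N0. lower N0 a \<le> lower N a \<and> upper N a \<le> upper N0 a) \<and>
    (\<forall>a\<in>set D. lower N a = upper N a))"

text \<open>The logarithm pays for the halvings of an arc, the 1 for the step that moves it to the
  finished arcs.\<close>

definition search_rank :: "search_state \<Rightarrow> nat" where
  "search_rank = (\<lambda>(N, T, D). \<Sum>a\<leftarrow>T. 1 + floorlog 2 (nat (upper N a - lower N a)))"

lemma search_inv_step:
  assumes "search_inv N0 c q z"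
  shows "search_inv N0 c q (search_step c q z)"
proof -
  obtain N T D where z: "z = (N, T, D)" by (cases z)
  show ?thesis
  proof (cases T)
    case Nil
    then show ?thesis using assms z by simp
  next
    case (Cons a T')
    have a: "a \<in> arcs_of N" and N: "valid_network N" "q \<in> cost_values N c"
      using assms by (auto simp: search_inv_def z Cons)
    show ?thesis
    proof (cases "lower N a < upper N a")
      case False
      then have "lower N a = upper N a" using N(1) a by (force simp: valid_network_def)
      then show ?thesis using assms False by (auto simp: search_inv_def z Cons)
    next
      case True
      note h = halve[OF N(1) a N(2)]
      have "lower N b \<le> lower (halve c q N a) b \<and> upper (halve c q N a) b \<le> upper N b" for b
        using h(3)[of b] h(4,5) by (cases "b = a") auto
      moreover have "lower (halve c q N a) b = lower N b \<and> upper (halve c q N a) b = upper N b"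
        if "b \<in> set D" for b
        using h(3)[of b] that assms by (auto simp: search_inv_def z Cons)
      moreover have "\<forall>b\<in>arcs_of N0. lower N0 b \<le> lower N b \<and> upper N b \<le> upper N0 b"
        "\<forall>b\<in>set D. lower N b = upper N b"
        using assms by (simp_all add: search_inv_def z)
      ultimately have
        "\<forall>b\<in>arcs_of N0. lower N0 b \<le> lower (halve c q N a) b \<and> upper (halve c q N a) b \<le> upper N0 b"
        "\<forall>b\<in>set D. lower (halve c q N a) b = upper (halve c q N a) b"
        by (meson order_trans, metis)
      then show ?thesis
        using assms True h(1,2,7,8,9) by (simp add: search_inv_def z Cons)
    qed
  qed
qed

lemma floorlog_half:
  assumes "0 < n" "2 * m \<le> n"
  shows "floorlog 2 m < floorlog 2 n"
proof -
  have "floorlog 2 n = floorlog 2 (n div 2) + 1" using assms by (subst compute_floorlog) simp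
  moreover have "floorlog 2 m \<le> floorlog 2 (n div 2)" using assms by (intro floorlog_mono) linarith
  ultimately show ?thesis by simp
qed

lemma search_rank_step:
  assumes "search_inv N0 c q (N, T, D)" "T \<noteq> []"
  shows "search_rank (search_step c q (N, T, D)) < search_rank (N, T, D)"
proof -
  obtain a T' where T: "T = a # T'" using assms(2) by (cases T) auto
  have a: "a \<in> arcs_of N" and N: "valid_network N" "q \<in> cost_values N c"
    and "a \<notin> set T'"
    using assms(1) by (auto simp: search_inv_def T)
  note h = halve[OF N(1) a N(2)]
  \<comment> \<open>Only the interval of \<open>a\<close> changes, and by distinctness
    \<open>a\<close> does not recur in \<open>T'\<close>.\<close>
  have "(\<Sum>b\<leftarrow>T'. 1 + floorlog 2 (nat (upper (halve c q N a) b - lower (halve c q N a) b))) =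
      (\<Sum>b\<leftarrow>T'. 1 + floorlog 2 (nat (upper N b - lower N b)))"
  proof (intro arg_cong[where f = sum_list] map_cong refl)
    fix b assume "b \<in> set T'"
    then have "b \<noteq> a" using \<open>a \<notin> set T'\<close> by blast
    then show "1 + floorlog 2 (nat (upper (halve c q N a) b - lower (halve c q N a) b)) =
        1 + floorlog 2 (nat (upper N b - lower N b))"
      using h(3) by simp
  qed
  moreover have "floorlog 2 (nat (upper (halve c q N a) a - lower (halve c q N a) a))
      < floorlog 2 (nat (upper N a - lower N a))" if "lower N a < upper N a"
    using that h(6) by (intro floorlog_half) (auto simp: nat_less_iff)
  ultimately show ?thesis
    by (auto simp: search_rank_def T)
qed

text \<open>Describes the outcome of the loop inside HOL; the program of \<open>pt_search\<close>
  realises it. Termination under the invariant comes from \<open>search_rank\<close>.\<close>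

definition search :: "cost \<Rightarrow> rat \<Rightarrow> search_state \<Rightarrow> search_state" where
  "search c q = while (\<lambda>(N, T, D). T \<noteq> []) (search_step c q)"

lemma search_unfold:
  "search c q (N, T, D) = (if T \<noteq> [] then search c q (search_step c q (N, T, D)) else (N, T, D))"
  unfolding search_def by (subst while_unfold) simp

lemma search_result:
  assumes "search_inv N0 c q z"
  shows "search_inv N0 c q (search c q z) \<and> fst (snd (search c q z)) = []"
  unfolding search_def
proof (rule while_rule[where P = "search_inv N0 c q" and r = "measure search_rank"])
  fix z assume "search_inv N0 c q z" "case z of (N, T, D) \<Rightarrow> T \<noteq> []"
  then show "(search_step c q z, z) \<in> measure search_rank"
    using search_rank_step by (cases z) auto
qed (use assms search_inv_step in auto)

text \<open>All capacity intervals are points, so a feasible flow agrees with \<open>lower N\<close>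
  on the arcs. Since \<open>q\<close> is still a cost value, such a flow exists and has cost
  \<open>q\<close>.\<close>

lemma search_flow:
  assumes "search_inv N0 c q (N, [], D)"
  shows "feasible N0 (lower N)" "flow_cost N0 c (lower N) = q" "distinct D" "set D = arcs_of N0"
proof -
  note inv = assms[unfolded search_inv_def prod.case]
  obtain f where f: "feasible N f" "q = flow_cost N c f" using inv by (auto simp: cost_values_def)
  have eq: "f a = lower N a" if "a \<in> arcs_of N0" for a
    using that inv f(1) by (fastforce simp: feasible_def)
  have "feasible N0 f" using f(1) inv by blast
  moreover have "(\<Sum>j | (i, j) \<in> arcs_of N0. f (i, j)) = (\<Sum>j | (i, j) \<in> arcs_of N0. lower N (i, j))"
    "(\<Sum>j | (j, i) \<in> arcs_of N0. f (j, i)) = (\<Sum>j | (j, i) \<in> arcs_of N0. lower N (j, i))" for i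
    by (rule sum.cong; simp add: eq)+
  ultimately show "feasible N0 (lower N)" by (simp add: feasible_def eq)
  have "q = flow_cost N0 c f" using f(2) inv by (simp add: flow_cost_def)
  also have "\<dots> = flow_cost N0 c (lower N)"
    unfolding flow_cost_def by (rule sum.cong) (simp_all add: eq)
  finally show "flow_cost N0 c (lower N) = q" ..
  show "distinct D" "set D = arcs_of N0" using inv by auto
qed


section \<open>Enumeration problems and polynomial-time transformations\<close>

lemma vlist_inject: "vlist xs = vlist ys \<longleftrightarrow> xs = ys"
proof (induction xs arbitrary: ys)
  case Nil
  show ?case by (cases ys) auto
next
  case (Cons x xs)
  then show ?case by (cases ys) auto
qed

text \<open>The definition grants some output for each pair of instance and code. One code stands
  for many instances, because values off the arcs are not recorded; determinism of
  \<open>exec\<close> makes the output a function of the code alone, as a subroutine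
  requires.\<close>

lemma output_poly_solvableE:
  assumes "output_poly_solvable code sol"
  obtains out where "\<And>i x. code i x \<Longrightarrow> sol i (out x)"
    and "pt {(i, x). code i x} (\<lambda>(i, x). length (out x)) (\<lambda>(i, x). x) (\<lambda>(i, x). vlist (out x))"
proof -
  obtain c p where cp: "\<And>i x. code i x \<Longrightarrow> \<exists>t s ys. exec c (init x) t s \<and> s 0 = vlist ys \<and>
      sol i ys \<and> t \<le> poly (poly p [:vsize x:]) (length ys)"
    using assms unfolding output_poly_solvable_def by blast
  define out where "out x = (SOME ys. \<exists>t s. exec c (init x) t s \<and> s 0 = vlist ys)" for x
  obtain k where k: "\<And>m n. poly (poly p [:n:]) m \<le> (m + n + 2) ^ k"
    using poly_bounded_nat_poly by blast
  define n where "n = prog_bound c"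
  have run: "\<exists>t. exec (Seq c (clear n)) (init x) t (init (vlist (out x))) \<and> sol i (out x) \<and>
      t \<le> (length (out x) + vsize x + 2) ^ k + (1 + 2 * n)" if ix: "code i x" for i x
  proof -
    obtain t s ys where run: "exec c (init x) t s" "s 0 = vlist ys"
      and ys: "sol i ys" "t \<le> poly (poly p [:vsize x:]) (length ys)"
      using cp[OF ix] by blast
    have "out x = ys"
      unfolding out_def
    proof (rule some_equality)
      fix zs assume "\<exists>t s. exec c (init x) t s \<and> s 0 = vlist zs"
      then show "zs = ys"
        using exec_deterministic[OF run(1)] run(2) by (auto simp: vlist_inject)
    qed (use run in blast)
    \<comment> \<open>Registers from \<open>n\<close> on were never written, so clearing 1 to
      \<open>n\<close> restores the shape \<open>init\<close>, which composition relies on.\<close>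
    moreover have "(\<lambda>y. if 0 < y \<and> y \<le> n then Num 0 else s y) = init (vlist ys)"
      using run(2) exec_unchanged[OF run(1)] by (auto simp: init_def n_def fun_eq_iff)
    then have "exec (Seq c (clear n)) (init x) (t + (1 + 2 * n)) (init (vlist ys))"
      using exec.Seq[OF run(1) exec_clear, of n] by simp
    ultimately show ?thesis
      using ys order_trans[OF ys(2) k] by auto
  qed
  then obtain T where T: "\<And>i x. code i x \<Longrightarrow>
      exec (Seq c (clear n)) (init x) (T i x) (init (vlist (out x))) \<and> sol i (out x) \<and>
      T i x \<le> (length (out x) + vsize x + 2) ^ k + (1 + 2 * n)"
    by metis
  have "pt {(i, x). code i x} (\<lambda>(i, x). length (out x)) (\<lambda>(i, x). x) (\<lambda>(i, x). vlist (out x))"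
  proof (rule ptI)
    let ?D = "{(i, x). code i x}" and ?b = "\<lambda>z. (case z of (i, x) \<Rightarrow> length (out x)) +
      vsize (case z of (i, x) \<Rightarrow> x)"
    have "poly_bounded ?D (\<lambda>z. (?b z + 2) ^ k + (1 + 2 * n)) ?b"
      by (intro poly_bounded_add poly_bounded_const) (rule poly_boundedI[where k = k], simp)
    then show "poly_bounded ?D (\<lambda>(i, x). T i x) ?b"
      by (rule poly_bounded_mono) (use T in auto)
  qed (use T in auto)
  with T show ?thesis by (intro that) auto
qed

lemma output_poly_solvableI:
  assumes "pt {(i, x). code i x} (\<lambda>(i, x). length (out i x)) (\<lambda>(i, x). x) (\<lambda>(i, x). vlist (out i x))"
    and "\<And>i x. code i x \<Longrightarrow> sol i (out i x)"
  shows "output_poly_solvable code sol"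
proof -
  let ?D = "{(i, x). code i x}" and ?b = "\<lambda>z. (case z of (i, x) \<Rightarrow> length (out i x)) +
    vsize (case z of (i, x) \<Rightarrow> x)"
  obtain c T where c: "\<And>z. z \<in> ?D \<Longrightarrow> exec c (init (case z of (i, x) \<Rightarrow> x)) (T z)
      (init (case z of (i, x) \<Rightarrow> vlist (out i x)))"
    and "poly_bounded ?D T ?b"
    using assms(1) by (rule ptE) blast
  then obtain k where k: "\<And>z. z \<in> ?D \<Longrightarrow> T z \<le> (?b z + 2) ^ k"
    unfolding poly_bounded_def by blast
  show ?thesis
    unfolding output_poly_solvable_def
  proof (intro exI allI impI)
    fix i x assume ix: "code i x"
    then have z: "(i, x) \<in> ?D" by simp
    show "exec c (init x) (T (i, x)) (init (vlist (out i x))) \<and>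
        init (vlist (out i x)) 0 = vlist (out i x) \<and> sol i (out i x) \<and>
        T (i, x) \<le> poly (poly ([:[:2, 1:], [:1:]:] ^ k) [:vsize x:]) (length (out i x))"
      using c[OF z] k[OF z] assms(2)[OF ix] unfolding power_as_nat_poly by simp
  qed
qed


section \<open>Membership and sorting\<close>

lemma pt_member: "pt S r (\<lambda>a. Cell (vlist (ls a)) (w a)) (\<lambda>a. truth (w a \<in> set (ls a)))"
proof -
  have "fold (\<lambda>b s. s \<or> b = y) xs s \<longleftrightarrow> s \<or> y \<in> set xs" for y s and xs :: "val list"
    by (induction xs arbitrary: s) auto
  note mem = this[of _ _ False, simplified]
  have "pt S r (\<lambda>a. Cell (vlist (map (\<lambda>b. b) (ls a))) (Cell (w a) (truth False)))
    (\<lambda>a. truth (fold (\<lambda>b s. s \<or> b = w a) (ls a) False))"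
  proof (rule pt_fold[where st = "\<lambda>a s. truth s" and h = "\<lambda>a b s. s \<or> b = w a" and ?s0.0 = "\<lambda>a. False"])
    show "poly_bounded {(a, ys). a \<in> S \<and> (\<exists>zs. ls a = ys @ zs)}
        (\<lambda>(a, ys). vsize (truth (fold (\<lambda>b s. s \<or> b = w a) ys False)))
        (\<lambda>(a, ys). r a + vsize (vlist (map (\<lambda>b. b) (ls a))) + vsize (w a) + vsize (truth False))"
      by (rule poly_bounded_mono[OF poly_bounded_const[where c = 2]]) (auto simp: vsize_truth)
  \<comment> \<open>Disjunction is expressed as positivity of the sum of two truth values;
    \<open>Eq\<close> compares whole trees, so list elements may be arbitrary codes.\<close>
  qed (rule pt_expr[where e = "Less (Const 0) (Add (Right (Right (Var 0)))
          (Eq (Left (Var 0)) (Left (Right (Var 0)))))"], auto simp: truth_def split: if_splits)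
  then have "pt S r (\<lambda>a. Cell (vlist (ls a)) (Cell (w a) (Num 0))) (\<lambda>a. truth (w a \<in> set (ls a)))"
    by (simp add: mem truth_def)
  then show ?thesis
    by (rule pt_comp[rotated])
      (rule pt_expr[where e = "Cons (Left (Var 0)) (Cons (Right (Var 0)) (Const 0))"], simp)
qed

text \<open>The form in which the oracle reports a cost value. It is kept as the representation of
  \<open>q\<close> throughout, so answers never have to be converted.\<close>

definition opposite_code :: "rat \<Rightarrow> val" where
  "opposite_code q = vector_code (q, - q)"

lemma opposite_code_inject: "opposite_code p = opposite_code q \<longleftrightarrow> p = q"
  by (auto simp: opposite_code_def vector_code_def rat_code_def quotient_of_inject_eq
      split: prod.splits intro: quotient_of_inject)

text \<open>Comparison by cross multiplication, legitimate because \<open>quotient_of\<close> yields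
  positive denominators.\<close>

definition rat_less_expr :: "expr \<Rightarrow> expr \<Rightarrow> expr" where
  "rat_less_expr d e = Less (Mul (Left (Left d)) (Right (Left e))) (Mul (Left (Left e)) (Right (Left d)))"

lemma eval_rat_less_expr:
  assumes "eval_expr d s = opposite_code p" "eval_expr e s = opposite_code q"
  shows "eval_expr (rat_less_expr d e) s = truth (p < q)"
  using assms
  by (auto simp: rat_less_expr_def opposite_code_def vector_code_def rat_code_def rat_less_code
      mult.commute split: prod.splits)

lemma pt_append_rev: "pt S r (\<lambda>a. Cell (vlist (xs a)) (vlist (ys a))) (\<lambda>a. vlist (rev (xs a) @ ys a))"
proof -
  have "pt {(a, b). a \<in> S \<and> b \<in> set (xs a)} (\<lambda>(a, b). r a) (\<lambda>(a, b). Cell b (Num 0)) (\<lambda>(a, b). b)"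
    by (rule pt_expr[where e = "Left (Var 0)"]) auto
  from pt_map[OF this, where acc = ys]
  have "pt S r (\<lambda>a. Cell (vlist (xs a)) (Cell (Num 0) (vlist (ys a)))) (\<lambda>a. vlist (rev (xs a) @ ys a))"
    by simp
  then show ?thesis
    by (rule pt_comp[rotated])
      (rule pt_expr[where e = "Cons (Left (Var 0)) (Cons (Const 0) (Right (Var 0)))"], simp)
qed

text \<open>Valid for unsorted lists as well. It turns the recursion of \<open>insort\<close> into a
  loop: scan a prefix onto a stack, place \<open>x\<close>, and pour the stack back.\<close>

lemma insort_takeWhile:
  "insort x ys = takeWhile (\<lambda>y. y < x) ys @ x # dropWhile (\<lambda>y. y < x) ys"
  for x :: "'a::linorder"
  by (induction ys) auto

lemma pt_insort:
  "pt S r (\<lambda>a. Cell (vlist (map opposite_code (ls a))) (opposite_code (q a)))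
    (\<lambda>a. vlist (map opposite_code (insort (q a) (ls a))))"
proof -
  let ?l = "\<lambda>xs. vlist (map opposite_code xs)"
  define u where "u = (\<lambda>(R :: nat, x, xs, pre). Cell (?l xs) (Cell (opposite_code x) (?l pre)))"
  define v where "v = (\<lambda>(R :: nat, x, xs, pre).
    Cell (?l (dropWhile (\<lambda>y. y < x) xs))
      (Cell (opposite_code x) (?l (rev (takeWhile (\<lambda>y. y < x) xs) @ pre))))"
  \<comment> \<open>The ghost number in front bounds the size of the configuration and stays fixed;
    a step only moves an element from one list to the other, so the size is preserved.\<close>
  define S' where "S' = {z. vsize (u z) \<le> fst z}"
  define b where "b = (\<lambda>(R :: nat, x :: rat, xs, pre :: rat list). xs \<noteq> [] \<and> hd xs < x)"
  define step where "step = (\<lambda>(R :: nat, x :: rat, xs :: rat list, pre). (R, x, tl xs, hd xs # pre))"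
  have loop: "pt S' fst u v"
  proof (rule pt_while[where b = b and step = step and rank = "\<lambda>(R, x, xs, pre). length xs"
        and e = "Mul (IsCell (Left (Var 0))) (rat_less_expr (Left (Left (Var 0))) (Left (Right (Var 0))))"])
    show "pt {z \<in> S'. b z} fst u (\<lambda>z. u (step z))"
      by (rule pt_expr[where e = "Cons (Right (Left (Var 0))) (Cons (Left (Right (Var 0)))
            (Cons (Left (Left (Var 0))) (Right (Right (Var 0)))))"])
        (auto simp: b_def u_def step_def neq_Nil_conv)
  next
    fix z assume "z \<in> S'"
    obtain R x xs pre where z: "z = (R, x, xs, pre)" by (cases z)
    show "eval_expr (Mul (IsCell (Left (Var 0)))
        (rat_less_expr (Left (Left (Var 0))) (Left (Right (Var 0))))) (init (u z)) \<noteq> Num 0 \<longleftrightarrow> b z"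
    \<comment> \<open>The product is a conjunction without short circuit. On an empty list the
      comparison reads default values, and the factor 0 from \<open>IsCell\<close> decides.\<close>
    proof (cases xs)
      case Nil
      then show ?thesis by (simp add: z b_def u_def truth_def)
    next
      case (Cons y ys)
      have "eval_expr (rat_less_expr (Left (Left (Var 0))) (Left (Right (Var 0)))) (init (u z)) =
          truth (y < x)"
        by (rule eval_rat_less_expr) (simp_all add: z u_def Cons)
      then show ?thesis by (simp add: z b_def u_def Cons truth_def)
    qed
  next
    show "poly_bounded S' (\<lambda>z. vsize (u z)) fst"
      by (rule poly_bounded_le) (simp add: S'_def)
    have len: "length xs \<le> vsize (?l xs)" for xs
      by (induction xs) auto
    show "poly_bounded S' (\<lambda>(R, x, xs, pre). length xs) (\<lambda>z. fst z + vsize (u z))"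
    proof (rule poly_bounded_le)
      fix z :: "nat \<times> rat \<times> rat list \<times> rat list"
      obtain R x xs pre where "z = (R, x, xs, pre)" by (cases z)
      then show "(case z of (R, x, xs, pre) \<Rightarrow> length xs) \<le> fst z + vsize (u z)"
        using len[of xs] by (simp add: u_def)
    qed
  next
    fix z assume "z \<in> S'" "b z"
    then show "v (step z) = v z" "step z \<in> S'" "fst (step z) = fst z"
      "(case step z of (R, x, xs, pre) \<Rightarrow> length xs) < (case z of (R, x, xs, pre) \<Rightarrow> length xs)"
      by (auto simp: b_def step_def v_def S'_def u_def neq_Nil_conv)
  next
    fix z assume "z \<in> S'" "\<not> b z"
    then show "v z = u z"
      by (cases z, cases "fst (snd (snd z))") (auto simp: b_def v_def u_def)
  qed
  let ?in = "\<lambda>a. Cell (?l (ls a)) (Cell (opposite_code (q a)) (Num 0))"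
  have "pt S (\<lambda>a. vsize (?in a)) ?in (\<lambda>a. Cell (?l (dropWhile (\<lambda>y. y < q a) (ls a)))
      (Cell (opposite_code (q a)) (?l (rev (takeWhile (\<lambda>y. y < q a) (ls a))))))"
    by (rule pt_subst[OF loop, where h = "\<lambda>a. (vsize (?in a), q a, ls a, [])"])
      (auto simp: S'_def u_def v_def)
  then have 2: "pt S r ?in (\<lambda>a. Cell (?l (dropWhile (\<lambda>y. y < q a) (ls a)))
      (Cell (opposite_code (q a)) (?l (rev (takeWhile (\<lambda>y. y < q a) (ls a))))))"
    by (rule pt_resource) (rule poly_bounded_le, simp)
  have 1: "pt S r (\<lambda>a. Cell (?l (ls a)) (opposite_code (q a))) ?in"
    by (rule pt_expr[where e = "Cons (Left (Var 0)) (Cons (Right (Var 0)) (Const 0))"]) simp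
  have 3: "pt S r (\<lambda>a. Cell (?l (dropWhile (\<lambda>y. y < q a) (ls a)))
        (Cell (opposite_code (q a)) (?l (rev (takeWhile (\<lambda>y. y < q a) (ls a))))))
      (\<lambda>a. Cell (vlist (map opposite_code (rev (takeWhile (\<lambda>y. y < q a) (ls a)))))
        (vlist (map opposite_code (q a # dropWhile (\<lambda>y. y < q a) (ls a)))))"
    by (rule pt_expr[where e = "Cons (Right (Right (Var 0))) (Cons (Left (Right (Var 0))) (Left (Var 0)))"])
      simp
  have 4: "pt S r (\<lambda>a. Cell (vlist (map opposite_code (rev (takeWhile (\<lambda>y. y < q a) (ls a)))))
        (vlist (map opposite_code (q a # dropWhile (\<lambda>y. y < q a) (ls a)))))
      (\<lambda>a. ?l (insort (q a) (ls a)))"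
    by (rule pt_cong[OF pt_append_rev[where
            xs = "\<lambda>a. map opposite_code (rev (takeWhile (\<lambda>y. y < q a) (ls a)))"
            and ys = "\<lambda>a. map opposite_code (q a # dropWhile (\<lambda>y. y < q a) (ls a))"]])
      (simp_all add: insort_takeWhile rev_map)
  show ?thesis by (rule pt_comp[OF pt_comp[OF pt_comp[OF 1 2] 3] 4])
qed

text \<open>The oracle may list its vectors in any order, whereas the flows have to come with
  increasing costs.\<close>

lemma pt_sort:
  "pt S r (\<lambda>a. vlist (map opposite_code (ls a))) (\<lambda>a. vlist (map opposite_code (sort (ls a))))"
proof -
  let ?l = "\<lambda>xs. vlist (map opposite_code xs)"
  have "pt S r (\<lambda>a. Cell (?l (ls a)) (Cell (Num 0) (?l []))) (\<lambda>a. ?l (fold insort (ls a) []))"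
  proof (rule pt_fold[where st = "\<lambda>a. ?l" and h = "\<lambda>a. insort" and ?s0.0 = "\<lambda>a. []"])
    let ?D = "{(a, b, s). a \<in> S \<and> (\<exists>ys zs. ls a = ys @ b # zs \<and> s = fold insort ys [])}"
    have 1: "pt ?D (\<lambda>(a, b, s). r a) (\<lambda>(a, b, s). Cell (opposite_code b) (Cell (Num 0) (?l s)))
        (\<lambda>z. Cell (?l (snd (snd z))) (opposite_code (fst (snd z))))"
      by (rule pt_expr[where e = "Cons (Right (Right (Var 0))) (Left (Var 0))"]) auto
    show "pt ?D (\<lambda>(a, b, s). r a) (\<lambda>(a, b, s). Cell (opposite_code b) (Cell (Num 0) (?l s)))
        (\<lambda>(a, b, s). ?l (insort b s))"
      by (rule pt_cong[OF pt_comp[OF 1 pt_insort]]) auto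
  next
    \<comment> \<open>A partially sorted list is a permutation of the prefix read so far, so it has
      the same size; this is the bound that \<open>pt_fold\<close> asks for.\<close>
    have "vsize (?l (fold insort ys [])) = vsize (?l ys)" for ys
    proof -
      have "mset (fold insort ys []) = mset ys"
        by (simp flip: sort_conv_fold)
      then have "mset (map (\<lambda>x. Suc (vsize (opposite_code x))) (fold insort ys [])) =
          mset (map (\<lambda>x. Suc (vsize (opposite_code x))) ys)"
        by (simp only: mset_map)
      then have "sum_list (map (\<lambda>x. Suc (vsize (opposite_code x))) (fold insort ys [])) =
          sum_list (map (\<lambda>x. Suc (vsize (opposite_code x))) ys)"
        by (metis sum_mset_sum_list)
      then show ?thesis by (simp add: vsize_vlist comp_def)
    qed
    then show "poly_bounded {(a, ys). a \<in> S \<and> (\<exists>zs. ls a = ys @ zs)}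
        (\<lambda>(a, ys). vsize (?l (fold insort ys [])))
        (\<lambda>(a, ys). r a + vsize (?l (ls a)) + vsize (Num 0) + vsize (?l []))"
      by (intro poly_bounded_le) (auto simp: vsize_vlist)
  qed
  then have "pt S r (\<lambda>a. Cell (?l (ls a)) (Cell (Num 0) (Num 0))) (\<lambda>a. ?l (sort (ls a)))"
    by (simp add: sort_conv_fold)
  then show ?thesis
    by (rule pt_comp[rotated])
      (rule pt_expr[where e = "Cons (Var 0) (Cons (Const 0) (Const 0))"], simp)
qed


section \<open>Rewriting network codes\<close>

lemma arc_code_cong:
  "lower N a = lower N' a \<Longrightarrow> upper N a = upper N' a \<Longrightarrow> arc_code N cs a = arc_code N' cs a"
  by (simp add: arc_code_def)

lemma node_code_cong: "balance N = balance N' \<Longrightarrow> node_code N = node_code N'"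
  by (simp add: node_code_def fun_eq_iff)

lemma arc_code_one_cost:
  "arc_code N [c] a = Cell (Num (int (fst a))) (Cell (Num (int (snd a)))
    (Cell (Num (lower N a)) (Cell (Num (upper N a)) (Cell (rat_code (c a)) (Num 0)))))"
  by (simp add: arc_code_def)

lemma arc_code_two_costs:
  "arc_code N [c, d] a = Cell (Num (int (fst a))) (Cell (Num (int (snd a)))
    (Cell (Num (lower N a)) (Cell (Num (upper N a))
      (Cell (rat_code (c a)) (Cell (rat_code (d a)) (Num 0))))))"
  by (simp add: arc_code_def)

definition arc_expr :: "expr \<Rightarrow> expr \<Rightarrow> expr \<Rightarrow> expr \<Rightarrow> expr" where
  "arc_expr l u cs e = Cons (Left e) (Cons (Left (Right e)) (Cons l (Cons u cs)))"

abbreviation "lower_expr e \<equiv> Left (Right (Right e))"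
abbreviation "upper_expr e \<equiv> Left (Right (Right (Right e)))"
abbreviation "costs_expr e \<equiv> Right (Right (Right (Right e)))"

definition opposite_expr :: "expr \<Rightarrow> expr" where
  "opposite_expr e = arc_expr (lower_expr e) (upper_expr e)
    (Cons (Left (costs_expr e)) (Cons (Cons (Sub (Const 0) (Left (Left (costs_expr e))))
      (Right (Left (costs_expr e)))) (Const 0))) e"

text \<open>Negation keeps a fraction reduced and its denominator positive, so only the numerator
  changes.\<close>

lemma rat_code_uminus: "rat_code (- q) = Cell (Num (- num (left (rat_code q)))) (right (rat_code q))"
  by (auto simp: rat_code_def rat_uminus_code Let_def split: prod.splits)

lemma eval_opposite_expr:
  assumes "eval_expr e s = arc_code N [c] a"
  shows "eval_expr (opposite_expr e) s = arc_code N [c, \<lambda>b. - c b] a"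
  using assms
  by (simp add: opposite_expr_def arc_expr_def arc_code_one_cost arc_code_two_costs rat_code_uminus)

definition indicator_expr :: "int \<Rightarrow> expr \<Rightarrow> expr" where
  "indicator_expr z e = arc_expr (lower_expr e) (upper_expr e)
    (Cons (Cons (Const z) (Const 1)) (Cons (Cons (Const z) (Const 1)) (Const 0))) e"

text \<open>Codes must be reduced fractions; for an integer this forces denominator 1, as written by
  \<open>indicator_expr\<close>.\<close>

lemma rat_code_of_int: "rat_code (of_int z) = Cell (Num z) (Num 1)"
  using quotient_of_int[of z] by (simp add: rat_code_def Rat.of_int_def)

lemma eval_indicator_expr:
  assumes "eval_expr e s = arc_code N [c] b"
  shows "eval_expr (indicator_expr (if b = a then 1 else 0) e) s =
    arc_code N [arc_indicator a, arc_indicator a] b"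
  using assms rat_code_of_int[of 1] rat_code_of_int[of 0]
  by (simp add: indicator_expr_def arc_expr_def arc_code_one_cost arc_code_two_costs arc_indicator_def)

abbreviation nodes_code :: "network \<Rightarrow> nat list \<Rightarrow> val" where
  "nodes_code N vs \<equiv> vlist (map (node_code N) vs)"

abbreviation arcs_code :: "network \<Rightarrow> cost list \<Rightarrow> (nat \<times> nat) list \<Rightarrow> val" where
  "arcs_code N cs as \<equiv> vlist (map (arc_code N cs) as)"

text \<open>Assembles a query: pending arcs \<open>xs\<close> and finished arcs \<open>ys\<close>
  are rewritten uniformly and put in front of the current arc \<open>zs\<close>, which has been
  rewritten separately; \<open>w\<close> is the node list. The reversals are harmless, as
  \<open>network_code\<close> admits any order of arcs.\<close>

lemma pt_join:
  fixes el out :: "'a \<Rightarrow> 'b \<Rightarrow> val"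
  assumes el: "\<And>s b. s \<in> S \<Longrightarrow> b \<in> set (xs s) \<union> set (ys s) \<Longrightarrow>
    eval_expr e (init (el s b)) = out s b"
  shows "pt S r
    (\<lambda>s. Cell (w s) (Cell (vlist (map (el s) (xs s))) (Cell (vlist (map (el s) (ys s))) (vlist (zs s)))))
    (\<lambda>s. Cell (w s) (vlist (map (out s) (rev (xs s) @ rev (ys s)) @ zs s)))"
proof -
  have sub: "pt {(s, b). s \<in> S \<and> b \<in> set (xs s) \<union> set (ys s)} (\<lambda>(s, b). r s)
      (\<lambda>(s, b). Cell (el s b) (Num 0)) (\<lambda>(s, b). out s b)"
  proof (rule pt_comp)
    show "pt {(s, b). s \<in> S \<and> b \<in> set (xs s) \<union> set (ys s)} (\<lambda>(s, b). r s)
        (\<lambda>(s, b). Cell (el s b) (Num 0)) (\<lambda>(s, b). el s b)"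
      by (rule pt_expr[where e = "Left (Var 0)"]) auto
    show "pt {(s, b). s \<in> S \<and> b \<in> set (xs s) \<union> set (ys s)} (\<lambda>(s, b). r s)
        (\<lambda>(s, b). el s b) (\<lambda>(s, b). out s b)"
      by (rule pt_expr[where e = e]) (auto simp: el)
  qed
  have 1: "pt S r (\<lambda>s. Cell (vlist (map (el s) (ys s))) (Cell (Num 0) (vlist (zs s))))
      (\<lambda>s. vlist (rev (map (out s) (ys s)) @ zs s))"
    by (rule pt_map[OF pt_subset[OF sub]]) auto
  have 2: "pt S r (\<lambda>s. Cell (vlist (map (el s) (xs s)))
        (Cell (Num 0) (vlist (rev (map (out s) (ys s)) @ zs s))))
      (\<lambda>s. vlist (rev (map (out s) (xs s)) @ rev (map (out s) (ys s)) @ zs s))"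
    by (rule pt_map[OF pt_subset[OF sub]]) auto
  have 3: "pt S r
      (\<lambda>s. Cell (w s) (Cell (vlist (map (el s) (xs s))) (Cell (vlist (map (el s) (ys s))) (vlist (zs s)))))
      (\<lambda>s. Cell (Cell (vlist (map (el s) (ys s))) (Cell (Num 0) (vlist (zs s))))
        (Cell (w s) (vlist (map (el s) (xs s)))))"
    by (rule pt_expr[where e = "Cons (Cons (Left (Right (Right (Var 0))))
          (Cons (Const 0) (Right (Right (Right (Var 0)))))) (Cons (Left (Var 0)) (Left (Right (Var 0))))"])
      simp
  have 4: "pt S r
      (\<lambda>s. Cell (vlist (rev (map (out s) (ys s)) @ zs s)) (Cell (w s) (vlist (map (el s) (xs s)))))
      (\<lambda>s. Cell (w s) (Cell (vlist (map (el s) (xs s)))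
        (Cell (Num 0) (vlist (rev (map (out s) (ys s)) @ zs s)))))"
    by (rule pt_expr[where e = "Cons (Left (Right (Var 0))) (Cons (Right (Right (Var 0)))
          (Cons (Const 0) (Left (Var 0))))"])
      simp
  show ?thesis
    by (rule pt_cong[OF pt_comp[OF pt_comp[OF pt_comp[OF 3 pt_first[OF 1]] 4] pt_second[OF 2]]])
      (simp_all add: rev_map)
qed

text \<open>Capacities live inside the arc codes, so halving rewrites only the head of the first
  list.\<close>

definition search_code :: "cost \<Rightarrow> rat \<Rightarrow> nat list \<Rightarrow> search_state \<Rightarrow> val" where
  "search_code c q vs = (\<lambda>(N, T, D). Cell (arcs_code N [c] T) (Cell (arcs_code N [c] D)
    (Cell (nodes_code N vs) (opposite_code q))))"


section \<open>The search with an oracle for supported nondominated vectors\<close>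

text \<open>The oracle is no primitive of the model: \<open>oracle_pt\<close> says that a program
  computes it, with time charged to the length of the answer.\<close>

locale supported_oracle =
  fixes orc :: "val \<Rightarrow> val list"
  assumes oracle_solution: "bmcif_code I x \<Longrightarrow> supported_solution I (orc x)"
    and oracle_pt: "pt {(I, x). bmcif_code I x} (\<lambda>(I, x). length (orc x)) (\<lambda>(I, x). x)
      (\<lambda>(I, x). vlist (orc x))"
begin

lemma oracle_set:
  assumes "bmcif_code I x"
  shows "set (orc x) = vector_code ` supported_nondominated I"
    "length (orc x) = card (supported_nondominated I)"
    "\<exists>vs. distinct vs \<and> set vs = supported_nondominated I \<and> orc x = map vector_code vs"
proof -
  obtain vs where vs: "distinct vs" "set vs = supported_nondominated I" "orc x = map vector_code vs"
    using oracle_solution[OF assms] by (auto simp: supported_solution_def)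
  then show "set (orc x) = vector_code ` supported_nondominated I"
    "\<exists>vs. distinct vs \<and> set vs = supported_nondominated I \<and> orc x = map vector_code vs"
    by auto
  show "length (orc x) = card (supported_nondominated I)"
    using vs distinct_card[of vs] by simp
qed

text \<open>Callers bound the number of supported nondominated vectors, a property of the instance,
  instead of the answer of the oracle.\<close>

lemma pt_oracle:
  assumes "\<And>s. s \<in> S \<Longrightarrow> bmcif_code (I s) (x s)"
    and "\<And>s. s \<in> S \<Longrightarrow> card (supported_nondominated (I s)) \<le> r s"
  shows "pt S r x (\<lambda>s. vlist (orc (x s)))"
proof -
  have "pt S (\<lambda>s. length (orc (x s))) x (\<lambda>s. vlist (orc (x s)))"
    by (rule pt_subst[OF oracle_pt, where h = "\<lambda>s. (I s, x s)"]) (use assms(1) in auto)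
  moreover have "length (orc (x s)) \<le> r s + vsize (x s)" if "s \<in> S" for s
    using assms[OF that] oracle_set(2)[of "I s" "x s"] by simp
  ultimately show ?thesis
    by (rule pt_resource[OF _ poly_bounded_le])
qed

lemma pt_min_flow:
  assumes ok: "\<And>s. s \<in> S \<Longrightarrow> valid_network (N s) \<and> distinct (a s # T s @ D s) \<and>
      set (a s # T s @ D s) = arcs_of (N s) \<and> distinct (vs s) \<and> set (vs s) = nodes (N s)"
  shows "pt S r (\<lambda>s. search_code (c s) (q s) (vs s) (N s, a s # T s, D s))
    (\<lambda>s. Num (min_flow (N s) (a s)))"
proof -
  let ?d = "\<lambda>s. arc_indicator (a s)"
  let ?x = "\<lambda>s. Cell (nodes_code (N s) (vs s))
    (arcs_code (N s) [?d s, ?d s] (rev (T s) @ rev (D s) @ [a s]))"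
  have 1: "pt S r (\<lambda>s. search_code (c s) (q s) (vs s) (N s, a s # T s, D s))
      (\<lambda>s. Cell (nodes_code (N s) (vs s)) (Cell (arcs_code (N s) [c s] (T s))
        (Cell (arcs_code (N s) [c s] (D s)) (vlist [arc_code (N s) [?d s, ?d s] (a s)]))))"
    by (rule pt_expr[where e = "Cons (Left (Right (Right (Var 0)))) (Cons (Right (Left (Var 0)))
          (Cons (Left (Right (Var 0))) (Cons (indicator_expr 1 (Left (Left (Var 0)))) (Const 0))))"])
      (auto simp: search_code_def intro!: eval_indicator_expr[where a = a and b = a for a, simplified])
  \<comment> \<open>The head already carries the indicator value 1; by distinctness all remaining
    arcs differ from it and get 0.\<close>
  have 2: "pt S r (\<lambda>s. Cell (nodes_code (N s) (vs s)) (Cell (arcs_code (N s) [c s] (T s))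
        (Cell (arcs_code (N s) [c s] (D s)) (vlist [arc_code (N s) [?d s, ?d s] (a s)])))) ?x"
  proof (rule pt_cong[OF pt_join[where e = "indicator_expr 0 (Var 0)"]])
    fix s b assume "s \<in> S" "b \<in> set (T s) \<union> set (D s)"
    then have "b \<noteq> a s" using ok by fastforce
    then show "eval_expr (indicator_expr 0 (Var 0)) (init (arc_code (N s) [c s] b)) =
        arc_code (N s) [?d s, ?d s] b"
      using eval_indicator_expr[of "Var 0" "init (arc_code (N s) [c s] b)" "N s" "c s" b "a s"]
      by simp
  qed simp_all
  have code: "bmcif_code (N s, ?d s, ?d s) (?x s)" if "s \<in> S" for s
    unfolding bmcif_code.simps network_code_def
    using ok[OF that] by (intro conjI exI[of _ "vs s"] exI[of _ "rev (T s) @ rev (D s) @ [a s]"]) auto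
  have sn: "supported_nondominated (N s, ?d s, ?d s) =
      {(of_int (min_flow (N s) (a s)), of_int (min_flow (N s) (a s)))}" if "s \<in> S" for s
    by (rule supported_nondominated_arc_indicator) (use ok[OF that] in auto)
  \<comment> \<open>The answer consists of one vector, so this query is polynomial in the input
    alone.\<close>
  have "pt S (\<lambda>s. 1) ?x (\<lambda>s. vlist (orc (?x s)))"
    by (rule pt_oracle[OF code]) (simp_all add: sn)
  then have 3: "pt S r ?x (\<lambda>s. vlist (orc (?x s)))"
    by (rule pt_resource) (rule poly_bounded_const)
  have orc: "orc (?x s) = [vector_code (of_int (min_flow (N s) (a s)), of_int (min_flow (N s) (a s)))]"
    if "s \<in> S" for s
  proof -
    have "length (orc (?x s)) = 1" using oracle_set(2)[OF code[OF that]] sn[OF that] by simp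
    moreover have "set (orc (?x s)) = {vector_code (of_int (min_flow (N s) (a s)), of_int (min_flow (N s) (a s)))}"
      using oracle_set(1)[OF code[OF that]] sn[OF that] by simp
    ultimately show ?thesis by (cases "orc (?x s)") auto
  qed
  \<comment> \<open>Head of the answer list, first component of the vector, numerator; the
    denominator is 1.\<close>
  have 4: "pt S r (\<lambda>s. vlist (orc (?x s))) (\<lambda>s. Num (min_flow (N s) (a s)))"
    by (rule pt_expr[where e = "Left (Left (Left (Var 0)))"])
      (simp only: eval_expr.simps init_0 orc, simp add: vector_code_def rat_code_of_int)
  show ?thesis by (rule pt_comp[OF pt_comp[OF pt_comp[OF 1 2] 3] 4])
qed

lemma oracle_opposite:
  assumes "bmcif_code (N, c, \<lambda>a. - c a) x"
  obtains qs where "distinct qs" "set qs = cost_values N c" "orc x = map opposite_code qs"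
proof -
  obtain vs where vs: "distinct vs" "set vs = (\<lambda>q. (q, - q)) ` cost_values N c"
    "orc x = map vector_code vs"
    using oracle_set(3)[OF assms] by (auto simp: supported_nondominated_opposite)
  have pair: "v = (fst v, - fst v)" if "v \<in> set vs" for v
    using that vs(2) by auto
  have "map opposite_code (map fst vs) = map vector_code vs"
    using pair by (auto simp: opposite_code_def)
  moreover have "distinct (map fst vs)"
    using vs(1) pair by (auto simp: distinct_map inj_on_def) (metis pair)+
  moreover have "set (map fst vs) = cost_values N c" using vs(2) by (auto simp: image_image)
  ultimately show ?thesis using vs(3) by (intro that) auto
qed

text \<open>Since \<open>opposite_code\<close> is injective, a syntactic search through the answer
  decides membership of the rational number.\<close>

lemma pt_cost_values_member:
  assumes ok: "\<And>s. s \<in> S \<Longrightarrow> valid_network (N s) \<and> distinct (as s) \<and>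
      set (as s) = arcs_of (N s) \<and> distinct (vs s) \<and> set (vs s) = nodes (N s)"
    and card: "\<And>s. s \<in> S \<Longrightarrow> card (cost_values (N s) (c s)) \<le> r s"
  shows "pt S r
    (\<lambda>s. Cell (Cell (nodes_code (N s) (vs s)) (arcs_code (N s) [c s, \<lambda>a. - c s a] (as s))) (opposite_code (q s)))
    (\<lambda>s. truth (q s \<in> cost_values (N s) (c s)))"
proof -
  let ?x = "\<lambda>s. Cell (nodes_code (N s) (vs s)) (arcs_code (N s) [c s, \<lambda>a. - c s a] (as s))"
  have code: "bmcif_code (N s, c s, \<lambda>a. - c s a) (?x s)" if "s \<in> S" for s
    unfolding bmcif_code.simps network_code_def
    using ok[OF that] by (intro conjI exI[of _ "vs s"] exI[of _ "as s"]) auto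
  have "pt S r ?x (\<lambda>s. vlist (orc (?x s)))"
    by (rule pt_oracle[OF code])
      (simp_all add: supported_nondominated_opposite card_opposite_image card)
  then have 1: "pt S r (\<lambda>s. Cell (?x s) (opposite_code (q s)))
      (\<lambda>s. Cell (vlist (orc (?x s))) (opposite_code (q s)))"
    by (rule pt_first)
  have mem: "opposite_code (q s) \<in> set (orc (?x s)) \<longleftrightarrow> q s \<in> cost_values (N s) (c s)" if s: "s \<in> S" for s
  proof -
    obtain qs where qs: "set qs = cost_values (N s) (c s)" "orc (?x s) = map opposite_code qs"
      using oracle_opposite[OF code[OF s]] by metis
    have "opposite_code (q s) \<in> set (map opposite_code qs) \<longleftrightarrow> q s \<in> set qs"
      by (auto simp: opposite_code_inject)
    then show ?thesis by (simp only: qs)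
  qed
  have 2: "pt S r (\<lambda>s. Cell (vlist (orc (?x s))) (opposite_code (q s)))
      (\<lambda>s. truth (q s \<in> cost_values (N s) (c s)))"
    by (rule pt_cong[OF pt_member refl]) (rule arg_cong[where f = truth], rule mem)
  show ?thesis by (rule pt_comp[OF 1 2])
qed

text \<open>Both candidate codes of the head arc are prepared before the query; afterwards the
  branches merely select one of them.\<close>

lemma pt_halve:
  assumes ok: "\<And>s. s \<in> S \<Longrightarrow> valid_network (N s) \<and> distinct (a s # T s @ D s) \<and>
      set (a s # T s @ D s) = arcs_of (N s) \<and> distinct (vs s) \<and> set (vs s) = nodes (N s)"
    and card: "\<And>s. s \<in> S \<Longrightarrow> card (cost_values (N s) (c s)) \<le> r s"
  shows "pt S r (\<lambda>s. search_code (c s) (q s) (vs s) (N s, a s # T s, D s))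
    (\<lambda>s. search_code (c s) (q s) (vs s) (halve (c s) (q s) (N s) (a s), a s # T s, D s))"
proof -
  let ?u = "\<lambda>s. search_code (c s) (q s) (vs s) (N s, a s # T s, D s)"
  let ?L = "\<lambda>s. lower_half (N s) (a s)" and ?U = "\<lambda>s. upper_half (N s) (a s)"
  let ?l = "\<lambda>s. arc_code (?L s) [c s] (a s)" and ?h = "\<lambda>s. arc_code (?U s) [c s] (a s)"
  let ?y = "\<lambda>s. Cell (?l s) (Cell (?h s) (?u s))"
  let ?arc = "Left (Left (Right (Var 0)))"
  let ?mid = "Div (Add (Left (Var 0)) (upper_expr ?arc)) (Const 2)"
  have "pt S r (\<lambda>s. Cell (Num (min_flow (N s) (a s))) (?u s)) ?y"
    by (rule pt_expr[where e = "Cons (arc_expr (Left (Var 0)) ?mid (costs_expr ?arc) ?arc)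
          (Cons (arc_expr (Add ?mid (Const 1)) (upper_expr ?arc) (costs_expr ?arc) ?arc) (Right (Var 0)))"])
      (simp add: search_code_def arc_expr_def arc_code_one_cost lower_half_def upper_half_def)
  from pt_let[OF pt_min_flow[OF ok] this]
  have 1: "pt S r ?u ?y" by simp
  have other: "arc_code (?L s) cs b = arc_code (N s) cs b" "arc_code (?U s) cs b = arc_code (N s) cs b"
    if "b \<noteq> a s" for s b cs
    using that by (auto simp: lower_half_def upper_half_def intro!: arc_code_cong)
  have ne: "b \<noteq> a s" if "s \<in> S" "b \<in> set (T s) \<union> set (D s)" for s b
    using ok[OF that(1)] that(2) by auto
  have node: "node_code (?L s) = node_code (N s)" "node_code (?U s) = node_code (N s)" for s
    by (rule node_code_cong, simp add: lower_half_def upper_half_def)+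
  let ?x = "\<lambda>s. Cell (nodes_code (?L s) (vs s))
    (arcs_code (?L s) [c s, \<lambda>b. - c s b] (rev (T s) @ rev (D s) @ [a s]))"
  have "pt S r ?y (\<lambda>s. Cell (nodes_code (N s) (vs s)) (Cell (arcs_code (N s) [c s] (T s))
      (Cell (arcs_code (N s) [c s] (D s)) (vlist [arc_code (?L s) [c s, \<lambda>b. - c s b] (a s)]))))"
    by (rule pt_expr[where e = "Cons (Left (Right (Right (Right (Right (Var 0))))))
          (Cons (Right (Left (Right (Right (Var 0))))) (Cons (Left (Right (Right (Right (Var 0)))))
            (Cons (opposite_expr (Left (Var 0))) (Const 0))))"])
      (auto simp: search_code_def intro!: eval_opposite_expr)
  moreover have "pt S r (\<lambda>s. Cell (nodes_code (N s) (vs s)) (Cell (arcs_code (N s) [c s] (T s))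
      (Cell (arcs_code (N s) [c s] (D s)) (vlist [arc_code (?L s) [c s, \<lambda>b. - c s b] (a s)])))) ?x"
    by (rule pt_cong[OF pt_join[where e = "opposite_expr (Var 0)"
            and out = "\<lambda>s. arc_code (N s) [c s, \<lambda>b. - c s b]"
            and zs = "\<lambda>s. [arc_code (?L s) [c s, \<lambda>b. - c s b] (a s)]"]])
      (auto simp: node other ne vlist_inject intro!: eval_opposite_expr)
  ultimately have "pt S r ?y ?x" by (rule pt_comp)
  from pt_Cell[OF this pt_expr[where e = "Right (Right (Right (Right (Right (Var 0)))))"
        and v = "\<lambda>s. opposite_code (q s)"]]
  have 2: "pt S r ?y (\<lambda>s. Cell (?x s) (opposite_code (q s)))"
    by (simp add: search_code_def)
  let ?b = "\<lambda>s. q s \<in> cost_values (?L s) (c s)"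
  have "pt S r (\<lambda>s. Cell (?x s) (opposite_code (q s))) (\<lambda>s. truth (?b s))"
  proof (rule pt_cost_values_member)
    fix s assume s: "s \<in> S"
    then have N: "valid_network (N s)" "a s \<in> arcs_of (N s)" using ok by auto
    show "valid_network (?L s) \<and> distinct (rev (T s) @ rev (D s) @ [a s]) \<and>
        set (rev (T s) @ rev (D s) @ [a s]) = arcs_of (?L s) \<and> distinct (vs s) \<and>
        set (vs s) = nodes (?L s)"
      using valid_lower_half[OF N] ok[OF s] by (auto simp: lower_half_def)
    \<comment> \<open>Fewer flows have at most as many cost values, so the answer to this query fits
      into the resource of the unrestricted network.\<close>
    show "card (cost_values (?L s) (c s)) \<le> r s"
      using card_mono[OF finite_cost_values cost_values_lower_half, OF N(1) N] card[OF s]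
      by (rule order_trans)
  qed
  from pt_Cell[OF pt_comp[OF 2 this] pt_id]
  have 3: "pt S r ?y (\<lambda>s. Cell (truth (?b s)) (?y s))" .
  \<comment> \<open>Halving changes the code of the head arc only, so the other parts of the state
    are copied.\<close>
  have map: "map (arc_code (halve (c s) (q s) (N s) (a s)) [c s]) xs = map (arc_code (N s) [c s]) xs"
    if "s \<in> S" "set xs \<subseteq> set (T s) \<union> set (D s)" for s xs
    using other ne[OF that(1)] that(2) by (auto simp: halve_def)
  have 4: "pt S r (\<lambda>s. Cell (truth (?b s)) (?y s))
      (\<lambda>s. search_code (c s) (q s) (vs s) (halve (c s) (q s) (N s) (a s), a s # T s, D s))"
  proof (rule pt_if[where e = "Left (Var 0)"])
    let ?old = "Right (Right (Right (Var 0)))"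
    show "pt {s \<in> S. eval_expr (Left (Var 0)) (init (Cell (truth (?b s)) (?y s))) \<noteq> Num 0} r
        (\<lambda>s. Cell (truth (?b s)) (?y s))
        (\<lambda>s. search_code (c s) (q s) (vs s) (halve (c s) (q s) (N s) (a s), a s # T s, D s))"
      by (rule pt_expr[where e = "Cons (Cons (Left (Right (Var 0))) (Right (Left ?old))) (Right ?old)"])
        (auto simp: search_code_def truth_def map, auto simp: halve_def node)
    show "pt {s \<in> S. eval_expr (Left (Var 0)) (init (Cell (truth (?b s)) (?y s))) = Num 0} r
        (\<lambda>s. Cell (truth (?b s)) (?y s))
        (\<lambda>s. search_code (c s) (q s) (vs s) (halve (c s) (q s) (N s) (a s), a s # T s, D s))"
      by (rule pt_expr[where e = "Cons (Cons (Left (Right (Right (Var 0)))) (Right (Left ?old))) (Right ?old)"])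
        (auto simp: search_code_def truth_def map split: if_splits, auto simp: halve_def node)
  qed
  show ?thesis by (rule pt_comp[OF pt_comp[OF 1 3] 4])
qed

end


section \<open>Size of the search states and number of search steps\<close>

definition search_size :: "network \<Rightarrow> cost \<Rightarrow> rat \<Rightarrow> nat list \<Rightarrow> nat" where
  "search_size N c q vs = (\<Sum>a\<in>arcs_of N. 1 + vsize (arc_code N [c] a)) + vsize (nodes_code N vs) +
    vsize (opposite_code q)"

lemma search_inv_cost_values:
  "search_inv N0 c q (N, T, D) \<Longrightarrow> cost_values N c \<subseteq> cost_values N0 c"
  by (auto simp: search_inv_def cost_values_def flow_cost_def)

lemma search_code_size:
  assumes "search_inv N0 c q z"
  shows "vsize (search_code c q vs z) \<le> 2 * search_size N0 c q vs + 5"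
proof -
  obtain N T D where z: "z = (N, T, D)" by (cases z)
  note inv = assms[unfolded search_inv_def z prod.case]
  \<comment> \<open>The lower capacity may climb as far as the original upper one, so that the size
    of the latter can count twice; hence the factor 2. The constant 5 in the total is three
    \<open>Cell\<close> nodes and two list ends.\<close>
  have arc: "1 + vsize (arc_code N [c] a) \<le> 2 * (1 + vsize (arc_code N0 [c] a))"
    if "a \<in> arcs_of N0" for a
  proof -
    have "0 \<le> lower N a" "lower N a \<le> upper N a" "upper N a \<le> upper N0 a"
      using that inv by (auto simp: valid_network_def)
    then have "vsize (Num (lower N a)) \<le> vsize (Num (upper N0 a))"
      "vsize (Num (upper N a)) \<le> vsize (Num (upper N0 a))"
      by (auto intro!: vsize_Num_mono simp del: vsize.simps)
    then show ?thesis unfolding arc_code_one_cost by simp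
  qed
  have "(\<Sum>a\<leftarrow>T @ D. 1 + vsize (arc_code N [c] a)) = (\<Sum>a\<in>arcs_of N0. 1 + vsize (arc_code N [c] a))"
    using inv sum_list_distinct_conv_sum_set[of "T @ D"] by simp
  also have "\<dots> \<le> (\<Sum>a\<in>arcs_of N0. 2 * (1 + vsize (arc_code N0 [c] a)))"
    by (rule sum_mono) (rule arc)
  also have "\<dots> = 2 * (\<Sum>a\<in>arcs_of N0. 1 + vsize (arc_code N0 [c] a))"
    by (rule sum_distrib_left[symmetric])
  finally have "(\<Sum>a\<leftarrow>T. 1 + vsize (arc_code N [c] a)) + (\<Sum>a\<leftarrow>D. 1 + vsize (arc_code N [c] a)) \<le>
      2 * (\<Sum>a\<in>arcs_of N0. 1 + vsize (arc_code N0 [c] a))"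
    by simp
  moreover have "nodes_code N vs = nodes_code N0 vs"
    using inv node_code_cong[of N N0] by simp
  ultimately show ?thesis
    by (simp add: z search_code_def search_size_def vsize_vlist comp_def)
qed

text \<open>As lower capacities are nonnegative, the width of an interval is at most its upper end,
  whose bits are part of the arc code. Thus the number of steps is at most linear in the input
  size.\<close>

lemma search_rank_le:
  assumes "\<And>a. a \<in> set T \<Longrightarrow> 0 \<le> lower N a"
  shows "search_rank (N, T, D) \<le> vsize (arcs_code N [c] T)"
  using assms
proof (induction T)
  case (Cons a T)
  have "floorlog 2 (nat (upper N a - lower N a)) \<le> floorlog 2 (nat \<bar>upper N a\<bar>)"
    using Cons.prems[of a] by (intro floorlog_mono nat_mono) auto
  also have "\<dots> \<le> vsize (arc_code N [c] a)" by (simp add: arc_code_one_cost)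
  finally show ?case using Cons by (simp add: search_rank_def)
qed (simp add: search_rank_def)

definition final_flow :: "cost \<Rightarrow> rat \<Rightarrow> search_state \<Rightarrow> nat \<times> nat \<Rightarrow> int" where
  "final_flow c q z = lower (fst (search c q z))"

text \<open>The \<open>rev\<close> is the trace of \<open>pt_map\<close>; \<open>flow_code\<close>
  accepts the arcs in any order.\<close>

definition final_flow_code :: "cost \<Rightarrow> rat \<Rightarrow> search_state \<Rightarrow> val" where
  "final_flow_code c q z = vlist (map (\<lambda>a. vlist [Num (int (fst a)), Num (int (snd a)), Num (final_flow c q z a)])
    (rev (snd (snd (search c q z)))))"

lemma final_flow:
  assumes "search_inv N0 c q z"
  shows "feasible N0 (final_flow c q z)" "flow_cost N0 c (final_flow c q z) = q"
    "flow_code N0 (final_flow c q z) (final_flow_code c q z)"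
proof -
  obtain N T D where s: "search c q z = (N, T, D)" by (cases "search c q z")
  have "search_inv N0 c q (N, T, D)" "T = []"
    using search_result[OF assms] unfolding s by auto
  then have inv: "search_inv N0 c q (N, [], D)" by simp
  note flow = search_flow[OF inv]
  show "feasible N0 (final_flow c q z)" "flow_cost N0 c (final_flow c q z) = q"
    using flow by (simp_all add: final_flow_def s)
  show "flow_code N0 (final_flow c q z) (final_flow_code c q z)"
    unfolding flow_code_def final_flow_code_def using flow(3,4)
    by (intro exI[of _ "rev D"]) (simp add: s)
qed

section \<open>One flow for each cost value\<close>

context supported_oracle
begin

text \<open>The original network \<open>N0\<close> is carried along as a ghost, so that the
  resource, made of its number of cost values and its size, stays constant while the current network
  shrinks.\<close>

lemma pt_search:
  "pt {(N0, c, q, vs, z). distinct vs \<and> set vs = nodes N0 \<and> valid_network N0 \<and> search_inv N0 c q z}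
    (\<lambda>(N0, c, q, vs, z). card (cost_values N0 c) + search_size N0 c q vs)
    (\<lambda>(N0, c, q, vs, z). search_code c q vs z)
    (\<lambda>(N0, c, q, vs, z). search_code c q vs (search c q z))"
  (is "pt ?S ?r ?u ?v")
proof -
  let ?b = "\<lambda>(N0 :: network, c :: cost, q :: rat, vs :: nat list, N :: network,
    T :: (nat \<times> nat) list, D :: (nat \<times> nat) list). T \<noteq> []"
  let ?step = "\<lambda>(N0 :: network, c, q, vs :: nat list, z). (N0, c, q, vs, search_step c q z)"
  let ?B = "{g \<in> ?S. ?b g}"
  let ?head = "Left (Left (Var 0))"
  let ?test = "Less (lower_expr ?head) (upper_expr ?head)"
  have test: "eval_expr ?test (init (?u (N0, c, q, vs, N, a # T, D))) = truth (lower N a < upper N a)"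
    for N0 c q vs N a T D
    by (simp add: search_code_def arc_code_one_cost)
  have body: "pt ?B ?r ?u (\<lambda>g. ?u (?step g))"
  proof (rule pt_if[where e = ?test])
    let ?S1 = "{g \<in> ?B. eval_expr ?test (init (?u g)) \<noteq> Num 0}"
    have S1: "\<exists>N0 c q vs N a T D. g = (N0, c, q, vs, N, a # T, D) \<and> distinct vs \<and>
        set vs = nodes N0 \<and> valid_network N0 \<and> search_inv N0 c q (N, a # T, D) \<and>
        lower N a < upper N a" if gS: "g \<in> ?S1" for g
    proof -
      obtain N0 c q vs N T D where g: "g = (N0, c, q, vs, N, T, D)" by (cases g)
      then obtain a T' where T: "T = a # T'" using gS by (cases T) auto
      then have "lower N a < upper N a"
        using CollectD[OF gS] unfolding g T test by (auto simp: truth_def split: if_splits)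
      then show ?thesis using gS unfolding g T by auto
    qed
    let ?N = "\<lambda>(N0, c, q, vs, N, T, D). N" and ?a = "\<lambda>(N0, c, q, vs, N, T, D). hd T"
      and ?T = "\<lambda>(N0, c, q, vs, N, T, D). tl T" and ?D = "\<lambda>(N0, c, q, vs, N, T, D). D"
      and ?c = "\<lambda>(N0, c, q, vs, N, T, D). c" and ?q = "\<lambda>(N0, c, q, vs, N, T, D). q"
      and ?vs = "\<lambda>(N0, c, q, vs, N, T, D). vs"
    have "pt ?S1 ?r (\<lambda>g. search_code (?c g) (?q g) (?vs g) (?N g, ?a g # ?T g, ?D g))
        (\<lambda>g. search_code (?c g) (?q g) (?vs g) (halve (?c g) (?q g) (?N g) (?a g), ?a g # ?T g, ?D g))"
    proof (rule pt_halve)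
      fix g assume gS: "g \<in> ?S1"
      obtain N0 c q vs N a T D where g: "g = (N0, c, q, vs, N, a # T, D)" "distinct vs"
        "set vs = nodes N0" "valid_network N0" and inv: "search_inv N0 c q (N, a # T, D)"
        using S1[OF gS] by blast
      show "valid_network (?N g) \<and> distinct (?a g # ?T g @ ?D g) \<and>
          set (?a g # ?T g @ ?D g) = arcs_of (?N g) \<and> distinct (?vs g) \<and> set (?vs g) = nodes (?N g)"
        using g inv by (auto simp: search_inv_def)
      have "card (cost_values N c) \<le> card (cost_values N0 c)"
        by (rule card_mono[OF finite_cost_values[OF g(4)] search_inv_cost_values[OF inv]])
      then show "card (cost_values (?N g) (?c g)) \<le> ?r g" by (simp add: g(1))
    qed
    then show "pt ?S1 ?r ?u (\<lambda>g. ?u (?step g))"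
    proof (rule pt_cong)
      fix g assume gS: "g \<in> ?S1"
      obtain N0 c q vs N a T D where g: "g = (N0, c, q, vs, N, a # T, D)" "lower N a < upper N a"
        using S1[OF gS] by blast
      show "search_code (?c g) (?q g) (?vs g) (?N g, ?a g # ?T g, ?D g) = ?u g"
        "search_code (?c g) (?q g) (?vs g) (halve (?c g) (?q g) (?N g) (?a g), ?a g # ?T g, ?D g) =
          ?u (?step g)"
        by (simp_all add: g)
    qed
    let ?S2 = "{g \<in> ?B. eval_expr ?test (init (?u g)) = Num 0}"
    show "pt ?S2 ?r ?u (\<lambda>g. ?u (?step g))"
    proof (rule pt_expr[where e = "Cons (Right (Left (Var 0))) (Cons (Cons ?head (Left (Right (Var 0))))
          (Right (Right (Var 0))))"])
      fix g assume g2: "g \<in> ?S2"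
      obtain N0 c q vs N T D where g: "g = (N0, c, q, vs, N, T, D)" by (cases g)
      then obtain a T' where T: "T = a # T'" using g2 by (cases T) auto
      have "\<not> lower N a < upper N a"
        using CollectD[OF g2] unfolding g T test by (auto simp: truth_def split: if_splits)
      then show "eval_expr (Cons (Right (Left (Var 0))) (Cons (Cons ?head (Left (Right (Var 0))))
          (Right (Right (Var 0))))) (init (?u g)) = ?u (?step g)"
        by (simp add: g T search_code_def)
    qed
  qed
  show ?thesis
  proof (rule pt_while[where b = ?b and step = ?step and e = "IsCell (Left (Var 0))"
        and rank = "\<lambda>(N0, c, q, vs, z). search_rank z"])
    show "pt ?B ?r ?u (\<lambda>g. ?u (?step g))" by (rule body)
  next
    fix g assume g: "g \<in> ?S"
    show "eval_expr (IsCell (Left (Var 0))) (init (?u g)) \<noteq> Num 0 \<longleftrightarrow> ?b g"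
      by (cases g) (auto simp: search_code_def truth_def vlist_eq_Cell_iff)
    show "\<not> ?b g \<Longrightarrow> ?v g = ?u g"
      by (cases g) (simp add: search_unfold)
    assume b: "?b g"
    show "?step g \<in> ?S" using g by (cases g) (simp add: search_inv_step)
    show "?r (?step g) = ?r g" by (cases g) simp
    show "(case ?step g of (N0, c, q, vs, z) \<Rightarrow> search_rank z) < (case g of (N0, c, q, vs, z) \<Rightarrow> search_rank z)"
      using g b search_rank_step by auto
    show "?v (?step g) = ?v g"
      using b by (cases g) (auto simp: search_unfold[of c q _ "_" for c q])
  next
    have "poly_bounded ?S (\<lambda>g. 2 * ?r g + 5) ?r"
      by (intro poly_bounded_add poly_bounded_mult poly_bounded_const poly_bounded_le) auto
    then show "poly_bounded ?S (\<lambda>g. vsize (?u g)) ?r"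
    proof (rule poly_bounded_mono)
      fix g assume g: "g \<in> ?S"
      obtain N0 c q vs z where g': "g = (N0, c, q, vs, z)" by (cases g)
      have "search_inv N0 c q z" using g by (simp add: g')
      from search_code_size[OF this, of vs] show "vsize (?u g) \<le> 2 * ?r g + 5"
        by (simp add: g')
    qed
    show "poly_bounded ?S (\<lambda>(N0, c, q, vs, z). search_rank z) (\<lambda>g. ?r g + vsize (?u g))"
    proof (rule poly_bounded_le)
      fix g assume g: "g \<in> ?S"
      obtain N0 c q vs N T D where g': "g = (N0, c, q, vs, N, T, D)" by (cases g)
      have "set T \<subseteq> arcs_of N" "valid_network N"
        using g by (auto simp: g' search_inv_def)
      then have "\<And>a. a \<in> set T \<Longrightarrow> 0 \<le> lower N a"
        by (auto simp only: valid_network_def subset_iff)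
      from search_rank_le[where T = T and D = D and c = c, OF this]
      show "(case g of (N0, c, q, vs, z) \<Rightarrow> search_rank z) \<le> ?r g + vsize (?u g)"
        by (simp add: g' search_code_def)
    qed
  qed
qed

lemma pt_final_flow:
  assumes "\<And>s. s \<in> S \<Longrightarrow> valid_network (N s) \<and> distinct (as s) \<and> set (as s) = arcs_of (N s) \<and>
      distinct (vs s) \<and> set (vs s) = nodes (N s) \<and> q s \<in> cost_values (N s) (c s)"
    and "\<And>s. s \<in> S \<Longrightarrow> card (cost_values (N s) (c s)) \<le> r s"
  shows "pt S r
    (\<lambda>s. Cell (opposite_code (q s)) (Cell (nodes_code (N s) (vs s)) (arcs_code (N s) [c s] (as s))))
    (\<lambda>s. final_flow_code (c s) (q s) (N s, as s, []))"
proof -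
  let ?u = "\<lambda>s. search_code (c s) (q s) (vs s) (N s, as s, [])"
  let ?z = "\<lambda>s. search (c s) (q s) (N s, as s, [])"
  have inv: "search_inv (N s) (c s) (q s) (N s, as s, [])" if "s \<in> S" for s
    using assms(1)[OF that] by (simp add: search_inv_def)
  have 1: "pt S r (\<lambda>s. Cell (opposite_code (q s)) (Cell (nodes_code (N s) (vs s)) (arcs_code (N s) [c s] (as s)))) ?u"
    by (rule pt_expr[where e = "Cons (Right (Right (Var 0))) (Cons (Const 0)
          (Cons (Left (Right (Var 0))) (Left (Var 0))))"])
      (simp add: search_code_def)
  have "pt S (\<lambda>s. card (cost_values (N s) (c s)) + search_size (N s) (c s) (q s) (vs s)) ?u
      (\<lambda>s. search_code (c s) (q s) (vs s) (?z s))"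
    by (rule pt_subst[OF pt_search, where h = "\<lambda>s. (N s, c s, q s, vs s, N s, as s, [])"])
      (use assms(1) inv in auto)
  \<comment> \<open>At the start the reference size is visible in the input itself, so only the
    number of cost values remains as resource.\<close>
  moreover have "card (cost_values (N s) (c s)) + search_size (N s) (c s) (q s) (vs s) \<le> r s + vsize (?u s)"
    if s: "s \<in> S" for s
  proof -
    have "(\<Sum>a\<in>arcs_of (N s). 1 + vsize (arc_code (N s) [c s] a)) =
        (\<Sum>a\<leftarrow>as s. 1 + vsize (arc_code (N s) [c s] a))"
      using assms(1)[OF s] by (metis sum_list_distinct_conv_sum_set)
    then show ?thesis
      using assms(2)[OF s] by (simp add: search_size_def search_code_def vsize_vlist comp_def)
  qed
  ultimately have 2: "pt S r ?u (\<lambda>s. search_code (c s) (q s) (vs s) (?z s))"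
    by (rule pt_resource[OF _ poly_bounded_le])
  have 3: "pt S r (\<lambda>s. search_code (c s) (q s) (vs s) (?z s))
      (\<lambda>s. Cell (arcs_code (fst (?z s)) [c s] (snd (snd (?z s)))) (Cell (Num 0) (vlist [])))"
    by (rule pt_expr[where e = "Cons (Left (Right (Var 0))) (Cons (Const 0) (Const 0))"])
      (simp add: search_code_def case_prod_beta)
  have "pt {(s, a). s \<in> S \<and> a \<in> set (snd (snd (?z s)))} (\<lambda>(s, a). r s)
      (\<lambda>(s, a). Cell (arc_code (fst (?z s)) [c s] a) (Num 0))
      (\<lambda>(s, a). vlist [Num (int (fst a)), Num (int (snd a)), Num (lower (fst (?z s)) a)])"
    by (rule pt_expr[where e = "Cons (Left (Left (Var 0))) (Cons (Left (Right (Left (Var 0))))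
          (Cons (lower_expr (Left (Var 0))) (Const 0)))"])
      (auto simp: arc_code_one_cost)
  from pt_map[OF this, where acc = "\<lambda>_. []"]
  have 4: "pt S r (\<lambda>s. Cell (arcs_code (fst (?z s)) [c s] (snd (snd (?z s)))) (Cell (Num 0) (vlist [])))
      (\<lambda>s. final_flow_code (c s) (q s) (N s, as s, []))"
    by (simp add: final_flow_code_def final_flow_def rev_map)
  show ?thesis by (rule pt_comp[OF pt_comp[OF pt_comp[OF 1 2] 3] 4])
qed

lemma pt_all_cost_values:
  assumes ok: "\<And>s. s \<in> S \<Longrightarrow> valid_network (N s) \<and> distinct (as s) \<and> set (as s) = arcs_of (N s) \<and>
      distinct (vs s) \<and> set (vs s) = nodes (N s)"
    and card: "\<And>s. s \<in> S \<Longrightarrow> card (cost_values (N s) (c s)) \<le> r s"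
  shows "pt S r (\<lambda>s. Cell (nodes_code (N s) (vs s)) (arcs_code (N s) [c s] (as s)))
    (\<lambda>s. vlist (map opposite_code (sorted_list_of_set (cost_values (N s) (c s)))))"
proof -
  let ?x = "\<lambda>s. Cell (nodes_code (N s) (vs s)) (arcs_code (N s) [c s, \<lambda>a. - c s a] (rev (as s)))"
  have 1: "pt S r (\<lambda>s. Cell (nodes_code (N s) (vs s)) (arcs_code (N s) [c s] (as s)))
      (\<lambda>s. Cell (nodes_code (N s) (vs s)) (Cell (arcs_code (N s) [c s] (as s))
        (Cell (arcs_code (N s) [c s] []) (vlist []))))"
    by (rule pt_expr[where e = "Cons (Left (Var 0)) (Cons (Right (Var 0)) (Cons (Const 0) (Const 0)))"])
      simp
  have 2: "pt S r (\<lambda>s. Cell (nodes_code (N s) (vs s)) (Cell (arcs_code (N s) [c s] (as s))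
        (Cell (arcs_code (N s) [c s] []) (vlist [])))) ?x"
    by (rule pt_cong[OF pt_join[where e = "opposite_expr (Var 0)" and ys = "\<lambda>_. []" and zs = "\<lambda>_. []"
            and out = "\<lambda>s. arc_code (N s) [c s, \<lambda>a. - c s a]"]])
      (auto intro!: eval_opposite_expr)
  have code: "bmcif_code (N s, c s, \<lambda>a. - c s a) (?x s)" if "s \<in> S" for s
    unfolding bmcif_code.simps network_code_def
    using ok[OF that] by (intro conjI exI[of _ "vs s"] exI[of _ "rev (as s)"]) auto
  have 3: "pt S r ?x (\<lambda>s. vlist (orc (?x s)))"
    by (rule pt_oracle[OF code])
      (simp_all add: supported_nondominated_opposite card_opposite_image card)
  have "\<exists>qs. distinct qs \<and> set qs = cost_values (N s) (c s) \<and> orc (?x s) = map opposite_code qs"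
    if "s \<in> S" for s
    using oracle_opposite[OF code[OF that]] by metis
  then obtain qs where qs: "\<And>s. s \<in> S \<Longrightarrow> distinct (qs s) \<and> set (qs s) = cost_values (N s) (c s) \<and>
      orc (?x s) = map opposite_code (qs s)"
    by metis
  have 4: "pt S r (\<lambda>s. vlist (orc (?x s)))
      (\<lambda>s. vlist (map opposite_code (sorted_list_of_set (cost_values (N s) (c s)))))"
  proof (rule pt_cong[OF pt_sort[where ls = qs]])
    fix s assume s: "s \<in> S"
    show "vlist (map opposite_code (qs s)) = vlist (orc (?x s))"
      using qs[OF s] by (simp only:)
    have "distinct (qs s)" using qs[OF s] by blast
    \<comment> \<open>Sorting a list without repetitions gives the canonical list of its set, so the
      order chosen by the oracle leaves no trace.\<close>
    have "sort (qs s) = sorted_list_of_set (set (qs s))"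
      by (simp add: sorted_list_of_set_sort_remdups distinct_remdups_id \<open>distinct (qs s)\<close>)
    then show "vlist (map opposite_code (sort (qs s))) =
        vlist (map opposite_code (sorted_list_of_set (cost_values (N s) (c s))))"
      using qs[OF s] by simp
  qed
  show ?thesis by (rule pt_comp[OF pt_comp[OF pt_comp[OF 1 2] 3] 4])
qed

lemma pt_all_flows:
  assumes ok: "\<And>s. s \<in> S \<Longrightarrow> valid_network (N s) \<and> distinct (as s) \<and> set (as s) = arcs_of (N s) \<and>
      distinct (vs s) \<and> set (vs s) = nodes (N s)"
    and card: "\<And>s. s \<in> S \<Longrightarrow> card (cost_values (N s) (c s)) \<le> r s"
  shows "pt S r (\<lambda>s. Cell (nodes_code (N s) (vs s)) (arcs_code (N s) [c s] (as s)))
    (\<lambda>s. vlist (map (\<lambda>q. final_flow_code (c s) q (N s, as s, []))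
      (sorted_list_of_set (cost_values (N s) (c s)))))"
proof -
  let ?x = "\<lambda>s. Cell (nodes_code (N s) (vs s)) (arcs_code (N s) [c s] (as s))"
  let ?qs = "\<lambda>s. sorted_list_of_set (cost_values (N s) (c s))"
  let ?out = "\<lambda>s q. final_flow_code (c s) q (N s, as s, [])"
  have fin: "finite (cost_values (N s) (c s))" if "s \<in> S" for s
    using ok[OF that] finite_cost_values by blast
  have "pt S r (\<lambda>s. Cell (vlist (map opposite_code (?qs s))) (?x s))
      (\<lambda>s. Cell (vlist (map opposite_code (?qs s))) (Cell (?x s) (vlist [])))"
    by (rule pt_expr[where e = "Cons (Left (Var 0)) (Cons (Right (Var 0)) (Const 0))"]) simp
  from pt_let[OF pt_all_cost_values[OF ok card] this]
  have 1: "pt S r ?x (\<lambda>s. Cell (vlist (map opposite_code (?qs s))) (Cell (?x s) (vlist [])))"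
    by simp
  have body: "pt {(s, q). s \<in> S \<and> q \<in> set (?qs s)} (\<lambda>(s, q). r s)
      (\<lambda>(s, q). Cell (opposite_code q) (?x s)) (\<lambda>(s, q). ?out s q)"
    by (rule pt_cong[OF pt_final_flow[where N = "\<lambda>(s, q). N s" and as = "\<lambda>(s, q). as s"
            and vs = "\<lambda>(s, q). vs s" and q = "\<lambda>(s, q). q" and c = "\<lambda>(s, q). c s"]])
      (use ok card fin in \<open>auto split: prod.splits\<close>)
  have 2: "pt S r (\<lambda>s. Cell (vlist (map opposite_code (?qs s))) (Cell (?x s) (vlist [])))
      (\<lambda>s. vlist (rev (map (?out s) (?qs s)) @ []))"
    by (rule pt_map[OF body])
  \<comment> \<open>Undoes the reversal of \<open>pt_map\<close>, since here the order matters: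
    costs have to increase.\<close>
  have 3: "pt S r (\<lambda>s. vlist (rev (map (?out s) (?qs s)) @ [])) (\<lambda>s. vlist (map (?out s) (?qs s)))"
    by (rule pt_cong[OF pt_rev[where ls = "\<lambda>s. rev (map (?out s) (?qs s))"]]) simp_all
  show ?thesis by (rule pt_comp[OF pt_comp[OF 1 2] 3])
qed

lemma acvf_solvable: "output_poly_solvable mcif_code acvf_solution"
proof -
  let ?S = "{(i, x). mcif_code i x}"
  have "\<exists>vs as. distinct vs \<and> set vs = nodes N \<and> distinct as \<and> set as = arcs_of N \<and>
      x = Cell (nodes_code N vs) (arcs_code N [c] as)" if "mcif_code (N, c) x" for N c x
    using that by (simp add: network_code_def)
  \<comment> \<open>The orders of nodes and arcs are extracted from the code by choice; they are
    ghosts and need not be computed.\<close>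
  then obtain vs as where enc: "\<And>N c x. mcif_code (N, c) x \<Longrightarrow>
      distinct (vs N c x) \<and> set (vs N c x) = nodes N \<and> distinct (as N c x) \<and>
      set (as N c x) = arcs_of N \<and> x = Cell (nodes_code N (vs N c x)) (arcs_code N [c] (as N c x))"
    by metis
  have decode: "Cell (nodes_code N (vs N c x)) (arcs_code N [c] (as N c x)) = x"
    if "mcif_code (N, c) x" for N c x
    using enc[OF that] by metis
  define out where "out = (\<lambda>(N, c) x. map (\<lambda>q. final_flow_code c q (N, as N c x, []))
    (sorted_list_of_set (cost_values N c)))"
  have "pt ?S (\<lambda>(i, x). card (cost_values (fst i) (snd i)))
      (\<lambda>s. Cell (nodes_code (fst (fst s)) (vs (fst (fst s)) (snd (fst s)) (snd s)))
        (arcs_code (fst (fst s)) [snd (fst s)] (as (fst (fst s)) (snd (fst s)) (snd s))))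
      (\<lambda>s. vlist (map (\<lambda>q. final_flow_code (snd (fst s)) q
          (fst (fst s), as (fst (fst s)) (snd (fst s)) (snd s), []))
        (sorted_list_of_set (cost_values (fst (fst s)) (snd (fst s))))))"
    by (rule pt_all_flows) (use enc in auto)
  \<comment> \<open>The resource, the number of cost values, is exactly the length of the output;
    this is where the ghost bound becomes output-polynomial time.\<close>
  then have pt: "pt ?S (\<lambda>(i, x). length (out i x)) (\<lambda>(i, x). x) (\<lambda>(i, x). vlist (out i x))"
    by (rule pt_subst[where h = "\<lambda>s. s"]) (auto simp: out_def decode)
  have "acvf_solution i (out i x)" if "mcif_code i x" for i x
  proof -
    obtain N c where i: "i = (N, c)" by (cases i)
    have N: "valid_network N" using that by (simp add: i)
    note enc = enc[OF that[unfolded i]]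
    let ?f = "\<lambda>q. final_flow c q (N, as N c x, [])"
    let ?qs = "sorted_list_of_set (cost_values N c)"
    have qs: "set ?qs = cost_values N c" using finite_cost_values[OF N] by simp
    have f: "feasible N (?f q)" "flow_cost N c (?f q) = q"
      "flow_code N (?f q) (final_flow_code c q (N, as N c x, []))" if "q \<in> cost_values N c" for q
    proof -
      have "search_inv N c q (N, as N c x, [])"
        using N enc that by (simp add: search_inv_def)
      from final_flow[OF this] show "feasible N (?f q)" "flow_cost N c (?f q) = q"
        "flow_code N (?f q) (final_flow_code c q (N, as N c x, []))" .
    qed
    have costs: "map (flow_cost N c) (map ?f ?qs) = ?qs"
      unfolding map_map using f(2) qs by (intro map_idI) simp
    show ?thesis
      unfolding i acvf_solution.simps
    proof (intro exI[of _ "map ?f ?qs"] conjI)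
      show "list_all2 (flow_code N) (map ?f ?qs) (out (N, c) x)"
        using f(3) qs by (auto simp: out_def list_all2_map1 list_all2_map2 simp: list_all2_same)
      show "\<forall>g\<in>set (map ?f ?qs). feasible N g" using f(1) qs by auto
      show "sorted_wrt (<) (map (flow_cost N c) (map ?f ?qs))"
        unfolding costs by (rule strict_sorted_list_of_set)
      show "\<forall>g. feasible N g \<longrightarrow> flow_cost N c g \<in> set (map (flow_cost N c) (map ?f ?qs))"
        unfolding costs qs by (auto simp: cost_values_def)
    qed
  qed
  with pt show ?thesis by (rule output_poly_solvableI)
qed

end

theorem theorem3p15:
  assumes "output_poly_solvable bmcif_code supported_solution"
  shows "output_poly_solvable mcif_code acvf_solution"
proof -
  obtain orc where "\<And>I x. bmcif_code I x \<Longrightarrow> supported_solution I (orc x)"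
    and "pt {(I, x). bmcif_code I x} (\<lambda>(I, x). length (orc x)) (\<lambda>(I, x). x) (\<lambda>(I, x). vlist (orc x))"
    using assms by (rule output_poly_solvableE) blast
  then interpret supported_oracle orc by unfold_locales
  show ?thesis by (rule acvf_solvable)
qed

end
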